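(* Let $x_0,a,b,\sigma$ be positive constants with $2a>\sigma^2$, and let $(X_t)_{t\in[0,T]}$ be the unique positive solution (the Cox-Ingersoll-Ross process) of the equation $$X_t=x_0+\int_0^t(a-bX_s)ds+\int_0^t\sigma\sqrt{X_s}\,dB_s,\quad t\in[0,T].$$ Then, for all $x\ge 0$, $$P\left(\sup_{0\le t\le T}e^{bt}(X_t-E[X_t])>x\right)\le 2\exp\left(-\frac{2x^2}{\left(\bar\sigma_T+\sqrt{\bar\sigma_T^2+\frac{\sqrt2\,\sigma^2}{b}(e^{bT}-1)\,x}\right)^2}\right),$$ where $\bar\sigma_T^2:=\sigma^2\left(\frac{x_0}{b}(e^{bT}-1)+\frac{a}{2b^2}(e^{bT}-1)^2\right)$.
   Context: $T>0$ is fixed and $B=(B_t)_{t\in[0,T]}$ is a standard Brownian motion on a complete probability space $(\Omega,\mathcal{F},P)$ with its natural filtration; stochastic integrals are Itô integrals. $\bar\sigma_T$ denotes the nonnegative square root of $\bar\sigma_T^2$. The condition $2a>\sigma^2$ ensures existence of a unique positive solution of the equation. *)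

theory Defs
  imports "HOL-Probability.Probability"
begin

section \<open>Brownian motion and its filtration\<close>

text \<open>Processes on the time interval from 0 to \<open>T\<close> are functions \<open>real \<Rightarrow> 'a \<Rightarrow> real\<close>; their values at
  times outside that interval are irrelevant.\<close>

definition brownian_motion :: "'a measure \<Rightarrow> real \<Rightarrow> (real \<Rightarrow> 'a \<Rightarrow> real) \<Rightarrow> bool" where
  "brownian_motion M T B \<longleftrightarrow>
     (\<forall>t\<in>{0..T}. B t \<in> borel_measurable M) \<and>
     (AE \<omega> in M. B 0 \<omega> = 0) \<and>
     (AE \<omega> in M. continuous_on {0..T} (\<lambda>t. B t \<omega>)) \<and>
     (\<forall>s t. 0 \<le> s \<and> s < t \<and> t \<le> T \<longrightarrow>
        distributed M lborel (\<lambda>\<omega>. B t \<omega> - B s \<omega>) (normal_density 0 (sqrt (t - s)))) \<and>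
     (\<forall>(n::nat) (\<tau>::nat \<Rightarrow> real).
        0 \<le> \<tau> 0 \<and> (\<forall>i<n. \<tau> i < \<tau> (Suc i)) \<and> \<tau> n \<le> T \<longrightarrow>
        prob_space.indep_vars M (\<lambda>_. borel) (\<lambda>i \<omega>. B (\<tau> (Suc i)) \<omega> - B (\<tau> i) \<omega>) {..<n})"

text \<open>The natural filtration carries the usual augmentation by the null sets of \<open>M\<close>; without it a
  stochastic integral need not have a continuous adapted version.\<close>

definition natural_filtration :: "'a measure \<Rightarrow> (real \<Rightarrow> 'a \<Rightarrow> real) \<Rightarrow> real \<Rightarrow> 'a measure" where
  "natural_filtration M B t =
     sigma (space M) ({B s -` A \<inter> space M | s A. 0 \<le> s \<and> s \<le> t \<and> A \<in> sets borel} \<union> null_sets M)"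

lemma space_natural_filtration [simp]: "space (natural_filtration M B t) = space M"
  unfolding natural_filtration_def by (rule space_measure_of_conv)

lemma filtration_natural_filtration: "filtration (space M) (natural_filtration M B)"
proof
  fix s t :: real
  assume "s \<le> t"
  then show "sets (natural_filtration M B s) \<subseteq> sets (natural_filtration M B t)"
    unfolding natural_filtration_def
    by (subst (1 2) sets_measure_of)
       (auto dest: sets.sets_into_space intro!: sigma_sets_mono' intro: order_trans)
qed simp

definition adapted_to :: "(real \<Rightarrow> 'a measure) \<Rightarrow> real \<Rightarrow> (real \<Rightarrow> 'a \<Rightarrow> real) \<Rightarrow> bool" where
  "adapted_to F T Y \<longleftrightarrow> (\<forall>t\<in>{0..T}. Y t \<in> borel_measurable (F t))"

definition prog_measurable :: "(real \<Rightarrow> 'a measure) \<Rightarrow> real \<Rightarrow> (real \<Rightarrow> 'a \<Rightarrow> real) \<Rightarrow> bool" where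
  "prog_measurable F T H \<longleftrightarrow>
     (\<forall>t\<in>{0..T}. (\<lambda>(s, \<omega>). H s \<omega>) \<in> borel_measurable (restrict_space borel {0..t} \<Otimes>\<^sub>M F t))"


section \<open>The Ito integral\<close>

text \<open>The triple \<open>(n, \<tau>, \<xi>)\<close> encodes the simple process that equals \<open>\<xi> i\<close> on the half-open interval
  from \<open>\<tau> i\<close> (excluded) to \<open>\<tau> (Suc i)\<close> (included), for \<open>i < n\<close>, and 0 elsewhere.\<close>

type_synonym 'a simple_proc = "nat \<times> (nat \<Rightarrow> real) \<times> (nat \<Rightarrow> 'a \<Rightarrow> real)"

definition is_simple_proc :: "'a measure \<Rightarrow> (real \<Rightarrow> 'a measure) \<Rightarrow> real \<Rightarrow> 'a simple_proc \<Rightarrow> bool" where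
  "is_simple_proc M F T = (\<lambda>(n, \<tau>, \<xi>).
     0 \<le> \<tau> 0 \<and> (\<forall>i<n. \<tau> i \<le> \<tau> (Suc i)) \<and> \<tau> n \<le> T \<and>
     (\<forall>i<n. \<xi> i \<in> borel_measurable (F (\<tau> i))) \<and>
     (\<exists>C. \<forall>i<n. \<forall>\<omega>\<in>space M. \<bar>\<xi> i \<omega>\<bar> \<le> C))"

definition simple_proc_val :: "'a simple_proc \<Rightarrow> real \<Rightarrow> 'a \<Rightarrow> real" where
  "simple_proc_val = (\<lambda>(n, \<tau>, \<xi>) s \<omega>. \<Sum>i<n. \<xi> i \<omega> * indicator {\<tau> i<..\<tau> (Suc i)} s)"

definition simple_proc_integral ::
    "(real \<Rightarrow> 'a \<Rightarrow> real) \<Rightarrow> 'a simple_proc \<Rightarrow> real \<Rightarrow> 'a \<Rightarrow> real" where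
  "simple_proc_integral B = (\<lambda>(n, \<tau>, \<xi>) t \<omega>.
     \<Sum>i<n. \<xi> i \<omega> * (B (min t (\<tau> (Suc i))) \<omega> - B (min t (\<tau> i)) \<omega>))"

definition tendsto_zero_in_prob :: "'a measure \<Rightarrow> (nat \<Rightarrow> 'a \<Rightarrow> ennreal) \<Rightarrow> bool" where
  "tendsto_zero_in_prob M Y \<longleftrightarrow>
     (\<forall>\<epsilon>>0. (\<lambda>n. measure M {\<omega> \<in> space M. Y n \<omega> > ennreal \<epsilon>}) \<longlonglongrightarrow> 0)"

text \<open>\<open>has_ito_integral M T B H I\<close>: the integrand \<open>H\<close> is progressively measurable with almost surely
  square integrable paths, and \<open>I\<close> is (a version of) the continuous adapted process
  \<open>t \<mapsto> \<integral>\<^sub>0\<^sup>t H\<^sub>s dB\<^sub>s\<close>, obtained as limit of the integrals of simple processes, uniformly in time, in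
  probability. Any two such \<open>I\<close> agree almost surely at all times simultaneously.\<close>

definition has_ito_integral ::
    "'a measure \<Rightarrow> real \<Rightarrow> (real \<Rightarrow> 'a \<Rightarrow> real) \<Rightarrow> (real \<Rightarrow> 'a \<Rightarrow> real) \<Rightarrow> (real \<Rightarrow> 'a \<Rightarrow> real) \<Rightarrow> bool" where
  "has_ito_integral M T B H I \<longleftrightarrow>
     prog_measurable (natural_filtration M B) T H \<and>
     (AE \<omega> in M. (\<integral>\<^sup>+s\<in>{0..T}. ennreal ((H s \<omega>)\<^sup>2) \<partial>lborel) < \<infinity>) \<and>
     adapted_to (natural_filtration M B) T I \<and>
     (AE \<omega> in M. continuous_on {0..T} (\<lambda>t. I t \<omega>)) \<and>
     (\<exists>S. (\<forall>n. is_simple_proc M (natural_filtration M B) T (S n)) \<and>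
          tendsto_zero_in_prob M
            (\<lambda>n \<omega>. \<integral>\<^sup>+s\<in>{0..T}. ennreal ((simple_proc_val (S n) s \<omega> - H s \<omega>)\<^sup>2) \<partial>lborel) \<and>
          tendsto_zero_in_prob M
            (\<lambda>n \<omega>. SUP t\<in>{0..T}. ennreal \<bar>simple_proc_integral B (S n) t \<omega> - I t \<omega>\<bar>))"


section \<open>The Cox-Ingersoll-Ross process\<close>

definition positive_CIR_solution ::
    "'a measure \<Rightarrow> real \<Rightarrow> (real \<Rightarrow> 'a \<Rightarrow> real) \<Rightarrow> real \<Rightarrow> real \<Rightarrow> real \<Rightarrow> real \<Rightarrow>
      (real \<Rightarrow> 'a \<Rightarrow> real) \<Rightarrow> bool" where
  "positive_CIR_solution M T B x\<^sub>0 a b \<sigma> X \<longleftrightarrow>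
     adapted_to (natural_filtration M B) T X \<and>
     (AE \<omega> in M. continuous_on {0..T} (\<lambda>t. X t \<omega>)) \<and>
     (AE \<omega> in M. \<forall>t\<in>{0..T}. X t \<omega> > 0) \<and>
     (\<exists>I. has_ito_integral M T B (\<lambda>s \<omega>. \<sigma> * sqrt (X s \<omega>)) I \<and>
          (AE \<omega> in M. \<forall>t\<in>{0..T}. X t \<omega> = x\<^sub>0 + (LBINT s:{0..t}. a - b * X s \<omega>) + I t \<omega>))"

definition CIR_sigma_bar_sq :: "real \<Rightarrow> real \<Rightarrow> real \<Rightarrow> real \<Rightarrow> real \<Rightarrow> real" where
  "CIR_sigma_bar_sq T x\<^sub>0 a b \<sigma> =
     \<sigma>\<^sup>2 * (x\<^sub>0 / b * (exp (b * T) - 1) + a / (2 * b\<^sup>2) * (exp (b * T) - 1)\<^sup>2)"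

definition CIR_sigma_bar :: "real \<Rightarrow> real \<Rightarrow> real \<Rightarrow> real \<Rightarrow> real \<Rightarrow> real" where
  "CIR_sigma_bar T x\<^sub>0 a b \<sigma> = sqrt (CIR_sigma_bar_sq T x\<^sub>0 a b \<sigma>)"

end

theory Submission
  imports Defs
begin

text \<open>The Laplace transform of \<open>X\<close> is explicit because the drift and the squared diffusion coefficient are
  affine. If \<open>\<psi>\<close> solves \<open>\<psi>' = b \<psi> - \<sigma>\<^sup>2 \<psi>\<^sup>2 / 2\<close> with \<open>\<psi> T = exp (b T) \<theta>\<close>, then \<open>exp (\<psi> X - a \<integral> \<psi>)\<close> is a
  nonnegative supermartingale, and on the event that \<open>exp (b t) (X\<^sub>t - E X\<^sub>t)\<close> exceeds \<open>x\<close> at some time this process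
  exceeds \<open>exp (\<theta> (x + E (exp (b T) X\<^sub>T)))\<close> up to its normalisation. The maximal inequality thus gives the bound
  \<open>exp (- \<theta> x + \<theta>\<^sup>2 v / (2 (1 - \<theta> c / 2)))\<close> with \<open>v\<close> the paper's \<open>\<sigma>\<close>-bar squared and
  \<open>c = \<sigma>\<^sup>2 (exp (b T) - 1) / b\<close>, and the optimal \<open>\<theta>\<close> yields the claim without the factor 2 and with \<open>c\<close> in
  place of \<open>sqrt 2 c\<close>.

  The supermartingale property needs no Ito formula. For a simple integrand it is a Gaussian computation;
  it passes to the Ito integral by Fatou's lemma, then to step functions \<open>\<psi>\<close> by multiplying over the
  intervals of a grid, and to smooth \<open>\<psi>\<close> by Fatou's lemma again, as the exponents converge pathwise.\<close>

section \<open>Brownian increments\<close>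

lemma nn_integral_exp_normal_density:
  fixes c s :: real
  assumes "s > 0"
  shows "(\<integral>\<^sup>+z. ennreal (exp (c * z - c\<^sup>2 * s / 2)) * ennreal (normal_density 0 (sqrt s) z) \<partial>lborel) = 1"
proof -
  \<comment> \<open>Completing the square: the exponential factor moves the mean to
    \<open>c * s\<close> and keeps the variance, so the integrand is again a probability
    density.\<close>
  have sq: "c * z - c\<^sup>2 * s / 2 - z\<^sup>2 / (2 * s) = - (z - c * s)\<^sup>2 / (2 * s)" for z
    using assms by (simp add: field_simps power2_eq_square)
  have "exp (c * z - c\<^sup>2 * s / 2) * exp (- z\<^sup>2 / (2 * s)) = exp (- (z - c * s)\<^sup>2 / (2 * s))" for z
    unfolding sq[symmetric] by (simp add: exp_add[symmetric])
  then have "exp (c * z - c\<^sup>2 * s / 2) * normal_density 0 (sqrt s) z = normal_density (c * s) (sqrt s) z" for z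
    using assms by (simp add: normal_density_def)
  then have "(\<integral>\<^sup>+z. ennreal (exp (c * z - c\<^sup>2 * s / 2)) * ennreal (normal_density 0 (sqrt s) z) \<partial>lborel)
      = (\<integral>\<^sup>+z. ennreal (normal_density (c * s) (sqrt s) z) \<partial>lborel)"
    by (simp add: ennreal_mult'[symmetric])
  also have "\<dots> = 1"
    using assms by (subst nn_integral_eq_integral) auto
  finally show ?thesis .
qed

text \<open>Hypothesis \<open>le\<close> is E[\<rho> | F] \<le> 1 without conditional expectations.
  On the sub-algebra it says that the measure with density \<rho> lies setwise below
  \<open>M\<close>, and the integral of a nonnegative function is monotone in the measure.\<close>

lemma nn_integral_mult_le_of_indicator_le:
  assumes sub: "subalgebra M F" and \<rho>: "\<rho> \<in> borel_measurable M" and f: "f \<in> borel_measurable F"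
    and le: "\<And>A. A \<in> sets F \<Longrightarrow> (\<integral>\<^sup>+\<omega>. indicator A \<omega> * \<rho> \<omega> \<partial>M) \<le> emeasure M A"
  shows "(\<integral>\<^sup>+\<omega>. f \<omega> * \<rho> \<omega> \<partial>M) \<le> (\<integral>\<^sup>+\<omega>. f \<omega> \<partial>M)"
proof -
  have fM: "f \<in> borel_measurable M"
    using sub f by (rule measurable_from_subalg)
  have sub': "subalgebra (density M \<rho>) F"
    using sub by (simp add: subalgebra_def)
  have "(\<integral>\<^sup>+\<omega>. f \<omega> * \<rho> \<omega> \<partial>M) = (\<integral>\<^sup>+\<omega>. f \<omega> \<partial>density M \<rho>)"
    using \<rho> fM by (subst nn_integral_density) (auto simp: mult.commute)
  also have "\<dots> = (\<integral>\<^sup>+\<omega>. f \<omega> \<partial>restr_to_subalg (density M \<rho>) F)"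
    by (rule nn_integral_subalgebra2[OF sub' f, symmetric])
  also have "\<dots> \<le> (\<integral>\<^sup>+\<omega>. f \<omega> \<partial>restr_to_subalg M F)"
  proof (rule nn_integral_mono_measure)
    show "sets (restr_to_subalg (density M \<rho>) F) = sets (restr_to_subalg M F)"
      by (simp add: sets_restr_to_subalg sub sub')
    show "restr_to_subalg (density M \<rho>) F \<le> restr_to_subalg M F"
    proof (subst le_measure, goal_cases)
      case 1 show ?case by (simp add: sets_restr_to_subalg sub sub')
    next
      case 2 show ?case
      proof
      fix A assume A: "A \<in> sets (restr_to_subalg (density M \<rho>) F)"
      then have AF: "A \<in> sets F" by (simp add: sets_restr_to_subalg sub')
      then have AM: "A \<in> sets M" using sub by (auto simp: subalgebra_def)
      show "emeasure (restr_to_subalg (density M \<rho>) F) A \<le> emeasure (restr_to_subalg M F) A"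
        using le[OF AF] AF AM \<rho>
        by (simp add: emeasure_restr_to_subalg sub sub' emeasure_density mult.commute)
      qed
    qed
  qed
  also have "\<dots> = (\<integral>\<^sup>+\<omega>. f \<omega> \<partial>M)"
    by (rule nn_integral_subalgebra2[OF sub f])
  finally show ?thesis .
qed

section \<open>Independence of increments from the augmented filtration\<close>

locale brownian = prob_space M for M :: "'a measure" +
  fixes T :: real and B :: "real \<Rightarrow> 'a \<Rightarrow> real"
  assumes brownian_motion: "brownian_motion M T B"
begin

abbreviation "F \<equiv> natural_filtration M B"

lemma measurable_B [measurable]: "0 \<le> t \<Longrightarrow> t \<le> T \<Longrightarrow> B t \<in> borel_measurable M"
  using brownian_motion by (simp add: brownian_motion_def)

lemma measurable_increment:
  "0 \<le> s \<Longrightarrow> s \<le> T \<Longrightarrow> 0 \<le> t \<Longrightarrow> t \<le> T \<Longrightarrow> (\<lambda>\<omega>. B t \<omega> - B s \<omega>) \<in> borel_measurable M"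
  by (intro borel_measurable_diff measurable_B)

lemma AE_B_0: "AE \<omega> in M. B 0 \<omega> = 0"
  using brownian_motion by (simp add: brownian_motion_def)

lemma AE_continuous_B: "AE \<omega> in M. continuous_on {0..T} (\<lambda>t. B t \<omega>)"
  using brownian_motion by (simp add: brownian_motion_def)

lemma distributed_increment:
  "0 \<le> s \<Longrightarrow> s < t \<Longrightarrow> t \<le> T \<Longrightarrow>
    distributed M lborel (\<lambda>\<omega>. B t \<omega> - B s \<omega>) (normal_density 0 (sqrt (t - s)))"
  using brownian_motion by (simp add: brownian_motion_def)

lemma indep_increments:
  fixes \<tau> :: "nat \<Rightarrow> real"
  shows "0 \<le> \<tau> 0 \<Longrightarrow> (\<And>i. i < n \<Longrightarrow> \<tau> i < \<tau> (Suc i)) \<Longrightarrow> \<tau> n \<le> T \<Longrightarrow>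
    indep_vars (\<lambda>_. borel) (\<lambda>i \<omega>. B (\<tau> (Suc i)) \<omega> - B (\<tau> i) \<omega>) {..<n}"
  using brownian_motion by (simp add: brownian_motion_def)

lemma sets_F: "sets (F t) = sigma_sets (space M)
    ({B s -` A \<inter> space M | s A. 0 \<le> s \<and> s \<le> t \<and> A \<in> sets borel} \<union> null_sets M)"
  unfolding natural_filtration_def
  by (rule sets_measure_of) (auto dest: sets.sets_into_space null_setsD2)

lemma sets_F_mono: "s \<le> t \<Longrightarrow> sets (F s) \<subseteq> sets (F t)"
  unfolding sets_F by (rule sigma_sets_mono') (blast intro: order_trans)

lemma sets_F_subset: "t \<le> T \<Longrightarrow> sets (F t) \<subseteq> sets M"
  unfolding sets_F by (rule sets.sigma_sets_subset) (auto intro!: measurable_sets measurable_B)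

lemma subalgebra_F: "t \<le> T \<Longrightarrow> subalgebra M (F t)"
  by (simp add: subalgebra_def sets_F_subset)

lemma measurable_F_mono: "f \<in> measurable (F s) N \<Longrightarrow> s \<le> t \<Longrightarrow> f \<in> measurable (F t) N"
  using sets_F_mono[of s t] unfolding measurable_def by auto

lemma measurable_F_M: "f \<in> measurable (F s) N \<Longrightarrow> s \<le> T \<Longrightarrow> f \<in> measurable M N"
  using measurable_from_subalg subalgebra_F by blast

lemma adapted_B: "0 \<le> s \<Longrightarrow> s \<le> t \<Longrightarrow> B s \<in> borel_measurable (F t)"
  by (rule measurableI) (auto simp: sets_F intro!: sigma_sets.Basic)

text \<open>Cylinder sets up to null sets form an intersection-stable generator of the augmented filtration.\<close>

definition cylinders :: "real \<Rightarrow> 'a set set" where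
  "cylinders s = {A \<in> sets M. \<exists>J C. finite J \<and> J \<subseteq> {0..s} \<and> (\<forall>r. C r \<in> sets borel) \<and>
     (AE \<omega> in M. \<omega> \<in> A \<longleftrightarrow> (\<forall>r\<in>J. B r \<omega> \<in> C r))}"

lemma Int_stable_cylinders: "Int_stable (cylinders s)"
proof (rule Int_stableI)
  fix A A' assume "A \<in> cylinders s" "A' \<in> cylinders s"
  then obtain J C J' C' where *: "A \<in> sets M" "A' \<in> sets M" "finite J" "J \<subseteq> {0..s}" "finite J'" "J' \<subseteq> {0..s}"
    "\<And>r. C r \<in> sets borel" "\<And>r. C' r \<in> sets borel"
    "AE \<omega> in M. \<omega> \<in> A \<longleftrightarrow> (\<forall>r\<in>J. B r \<omega> \<in> C r)"
    "AE \<omega> in M. \<omega> \<in> A' \<longleftrightarrow> (\<forall>r\<in>J'. B r \<omega> \<in> C' r)"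
    unfolding cylinders_def by blast
  let ?C = "\<lambda>r. (if r \<in> J then C r else UNIV) \<inter> (if r \<in> J' then C' r else UNIV)"
  have "AE \<omega> in M. \<omega> \<in> A \<inter> A' \<longleftrightarrow> (\<forall>r\<in>J \<union> J'. B r \<omega> \<in> ?C r)"
    using *(9,10) by eventually_elim auto
  moreover have "\<forall>r. ?C r \<in> sets borel" using *(7,8) by auto
  ultimately show "A \<inter> A' \<in> cylinders s"
    unfolding cylinders_def using *(1-6)
    by (intro CollectI conjI exI[of _ "J \<union> J'"] exI[of _ ?C]) auto
qed

lemma sets_F_cylinders:
  assumes "0 \<le> s" "s \<le> T"
  shows "sets (F s) \<subseteq> sigma_sets (space M) (cylinders s)"
  unfolding sets_F
proof (rule sigma_sets_mono', safe)
  fix r and A :: "real set" assume "0 \<le> r" "r \<le> s" "A \<in> sets borel"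
  then show "B r -` A \<inter> space M \<in> cylinders s"
    using assms unfolding cylinders_def
    by (intro CollectI conjI exI[of _ "{r}"] exI[of _ "\<lambda>_. A"]) (auto intro!: measurable_sets measurable_B)
next
  fix A assume A: "A \<in> null_sets M"
  \<comment> \<open>A null set is encoded by an unsatisfiable condition at index 0; an empty index
    set would describe the whole space.\<close>
  then have "AE \<omega> in M. \<omega> \<in> A \<longleftrightarrow> (\<forall>r\<in>{0}. B r \<omega> \<in> {})"
    using AE_not_in[OF A] by simp
  then show "A \<in> cylinders s"
    using assms A unfolding cylinders_def
    by (intro CollectI conjI exI[of _ "{0}"] exI[of _ "\<lambda>_. {}"]) auto
qed

text \<open>Independence is given for increments along a strictly increasing grid, whereas a
  cylinder constrains values of \<open>B\<close>. Since \<open>B 0\<close> vanishes almost surely,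
  each value is a partial sum of increments. So, up to a null set, \<open>A\<close> depends on the
  increments before \<open>s\<close> only, and the other event on the last increment.\<close>

lemma prob_cylinder_increment:
  assumes s: "0 \<le> s" "s < t" "t \<le> T" and A: "A \<in> cylinders s" and U: "U \<in> sets borel"
  shows "prob (A \<inter> {\<omega> \<in> space M. B t \<omega> - B s \<omega> \<in> U})
    = prob A * prob {\<omega> \<in> space M. B t \<omega> - B s \<omega> \<in> U}"
proof -
  from A obtain J C where J: "A \<in> sets M" "finite J" "J \<subseteq> {0..s}" "\<And>r. C r \<in> sets borel"
    and AE_A: "AE \<omega> in M. \<omega> \<in> A \<longleftrightarrow> (\<forall>r\<in>J. B r \<omega> \<in> C r)"
    unfolding cylinders_def by blast
  note [measurable] = J(1,4) U
  \<comment> \<open>Including 0 makes the partial sums start from \<open>B 0\<close>; including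
    \<open>s\<close> makes the last increment, after \<open>t\<close> is appended in
    \<open>\<tau>\<close>, exactly the one from \<open>s\<close> to \<open>t\<close>.\<close>
  define l where "l = sorted_list_of_set (insert 0 (insert s J))"
  define m where "m = length l - 1"
  define \<tau> where "\<tau> i = (if i \<le> m then l ! i else t)" for i
  have fin: "finite (insert 0 (insert s J))" using J by simp
  have setl: "set l = insert 0 (insert s J)" unfolding l_def using fin by (rule set_sorted_list_of_set)
  then have ne: "l \<noteq> []" by auto
  then have lenl: "length l = Suc m" unfolding m_def by (cases l) auto
  have strict: "sorted_wrt (<) l" unfolding l_def by simp
  have mono: "l ! i < l ! j" if "i < j" "j \<le> m" for i j
    using sorted_wrt_nth_less[OF strict that(1)] that lenl by simp
  have bounds: "0 \<le> l ! i" "l ! i \<le> s" if "i \<le> m" for i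
  proof -
    have "l ! i \<in> set l" using that lenl by simp
    then show "0 \<le> l ! i" "l ! i \<le> s" unfolding setl using J s by auto
  qed
  obtain i0 where i0: "i0 \<le> m" "l ! i0 = 0"
    using setl lenl by (metis in_set_conv_nth insertI1 less_Suc_eq_le)
  have l0: "l ! 0 = 0"
    using i0 bounds(1)[of 0] mono[of 0 i0] by (cases "i0 = 0") auto
  obtain i1 where i1: "i1 \<le> m" "l ! i1 = s"
    using setl lenl by (metis in_set_conv_nth insertI1 insertI2 less_Suc_eq_le)
  have lm: "l ! m = s"
    using i1 bounds(2)[of m] mono[of i1 m] by (cases "i1 = m") auto
  let ?D = "\<lambda>i \<omega>. B (\<tau> (Suc i)) \<omega> - B (\<tau> i) \<omega>"
  have Dm: "?D m \<omega> = B t \<omega> - B s \<omega>" for \<omega>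
    by (simp add: \<tau>_def lm)
  have indep: "indep_vars (\<lambda>_. borel) ?D {..<Suc m}"
  proof (rule indep_increments)
    fix i assume "i < Suc m"
    then show "\<tau> i < \<tau> (Suc i)"
      using mono[of i "Suc i"] lm s by (cases "i = m") (auto simp: \<tau>_def)
  qed (use l0 s in \<open>auto simp: \<tau>_def\<close>)
  have ind: "indep_var (PiM {..<m} (\<lambda>_. borel)) (\<lambda>\<omega>. restrict (\<lambda>i. ?D i \<omega>) {..<m})
      (PiM {m} (\<lambda>_. borel)) (\<lambda>\<omega>. restrict (\<lambda>i. ?D i \<omega>) {m})"
    by (rule indep_var_restrict[OF indep]) auto
  \<comment> \<open>The cylinder condition on the value at \<open>l ! k\<close>, expressed through
    the first \<open>k\<close> increments.\<close>
  define P where "P = {f \<in> space (PiM {..<m} (\<lambda>_. borel :: real measure)).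
      \<forall>k\<in>{k. k \<le> m \<and> l ! k \<in> J}. (\<Sum>i<k. f i) \<in> C (l ! k)}"
  have P: "P \<in> sets (PiM {..<m} (\<lambda>_. borel))"
    unfolding P_def
  proof (rule sets.sets_Collect_finite_All)
    fix k assume k: "k \<in> {k. k \<le> m \<and> l ! k \<in> J}"
    have "(\<lambda>f. \<Sum>i<k. f i) \<in> borel_measurable (PiM {..<m} (\<lambda>_. borel :: real measure))"
      by (rule borel_measurable_sum) (use k in \<open>auto intro!: measurable_component_singleton\<close>)
    from measurable_sets[OF this J(4)[of "l ! k"]]
    show "{f \<in> space (PiM {..<m} (\<lambda>_. borel :: real measure)). (\<Sum>i<k. f i) \<in> C (l ! k)} \<in> sets (PiM {..<m} (\<lambda>_. borel))"
      by (simp add: vimage_def Int_def conj_commute)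
  qed auto
  define Q where "Q = {f \<in> space (PiM {m} (\<lambda>_. borel :: real measure)). f m \<in> U}"
  have Q: "Q \<in> sets (PiM {m} (\<lambda>_. borel))"
    unfolding Q_def by measurable
  let ?A = "(\<lambda>\<omega>. restrict (\<lambda>i. ?D i \<omega>) {..<m}) -` P \<inter> space M"
  let ?E = "{\<omega> \<in> space M. B t \<omega> - B s \<omega> \<in> U}"
  have Q': "(\<lambda>\<omega>. restrict (\<lambda>i. ?D i \<omega>) {m}) -` Q \<inter> space M = ?E"
    by (auto simp: Q_def space_PiM Dm)
  have PQ: "(\<lambda>\<omega>. (restrict (\<lambda>i. ?D i \<omega>) {..<m}, restrict (\<lambda>i. ?D i \<omega>) {m})) -` (P \<times> Q) \<inter> space M = ?A \<inter> ?E"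
    unfolding Q'[symmetric] by auto
  have prod: "prob (?A \<inter> ?E) = prob ?A * prob ?E"
    using indep_varD[OF ind P Q] unfolding PQ Q' .
  have meas: "?A \<in> sets M"
    using measurable_sets[OF indep_var_rv1[OF ind] P] .
  have [measurable]: "(\<lambda>\<omega>. B t \<omega> - B s \<omega>) \<in> borel_measurable M"
    using s by (intro measurable_increment) auto
  have E: "?E \<in> sets M"
    by measurable
  have AE: "AE \<omega> in M. \<omega> \<in> A \<longleftrightarrow> \<omega> \<in> ?A"
    using AE_A AE_B_0 AE_space
  proof eventually_elim
    case (elim \<omega>)
    have sum: "(\<Sum>i<k. ?D i \<omega>) = B (l ! k) \<omega>" if "k \<le> m" for k
      using that elim l0 by (subst sum_lessThan_telescope) (auto simp: \<tau>_def)
    have "\<omega> \<in> ?A \<longleftrightarrow> (\<forall>k\<in>{k. k \<le> m \<and> l ! k \<in> J}. (\<Sum>i<k. ?D i \<omega>) \<in> C (l ! k))"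
      using elim by (auto simp: P_def space_PiM Ball_def)
    also have "\<dots> \<longleftrightarrow> (\<forall>k\<in>{k. k \<le> m \<and> l ! k \<in> J}. B (l ! k) \<omega> \<in> C (l ! k))"
      by (auto simp: sum)
    also have "\<dots> \<longleftrightarrow> (\<forall>r\<in>J. B r \<omega> \<in> C r)"
    proof safe
      fix r assume *: "\<forall>k\<in>{k. k \<le> m \<and> l ! k \<in> J}. B (l ! k) \<omega> \<in> C (l ! k)" "r \<in> J"
      then obtain k where "k < length l" "l ! k = r"
        using setl by (metis in_set_conv_nth insertI2)
      then show "B r \<omega> \<in> C r" using * lenl by auto
    qed auto
    finally show ?case using elim by auto
  qed
  have "prob A = prob ?A"
    by (rule finite_measure_eq_AE) (use AE J meas in auto)
  moreover have "prob (A \<inter> ?E) = prob (?A \<inter> ?E)"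
    by (rule finite_measure_eq_AE) (use AE J meas E in auto)
  ultimately show ?thesis using prod by simp
qed

text \<open>Dynkin's argument: the product formula passes to complements and countable disjoint
  unions, so it extends from the intersection-stable family \<open>cylinders s\<close> to the
  sigma-algebra generated by it, which contains \<open>F s\<close>.\<close>

lemma prob_F_increment:
  assumes s: "0 \<le> s" "s < t" "t \<le> T" and A: "A \<in> sets (F s)" and U: "U \<in> sets borel"
  shows "prob (A \<inter> {\<omega> \<in> space M. B t \<omega> - B s \<omega> \<in> U})
    = prob A * prob {\<omega> \<in> space M. B t \<omega> - B s \<omega> \<in> U}"
proof -
  let ?E = "{\<omega> \<in> space M. B t \<omega> - B s \<omega> \<in> U}"
  note [measurable] = U
  have [measurable]: "(\<lambda>\<omega>. B t \<omega> - B s \<omega>) \<in> borel_measurable M"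
    using s by (intro measurable_increment) auto
  have E: "?E \<in> sets M"
    by measurable
  have sub: "cylinders s \<subseteq> sets M" unfolding cylinders_def by auto
  have M: "A \<in> sets M" if "A \<in> sigma_sets (space M) (cylinders s)" for A
    using sets.sigma_sets_subset[OF sub] that by auto
  have closed: "cylinders s \<subseteq> Pow (space M)"
    using sub sets.space_closed by blast
  have "A \<in> sigma_sets (space M) (cylinders s)"
    using sets_F_cylinders[of s] s A by auto
  from Int_stable_cylinders closed this show ?thesis
  proof (induction rule: sigma_sets_induct_disjoint)
    case (basic A)
    then show ?case using prob_cylinder_increment[OF s _ U] by simp
  next
    case (compl A)
    have "(space M - A) \<inter> ?E = ?E - A \<inter> ?E" by auto
    then have "prob ((space M - A) \<inter> ?E) = prob ?E - prob (A \<inter> ?E)"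
      using M[OF compl(1)] E by (simp add: finite_measure_Diff sets.Int)
    then show ?case
      using compl M[OF compl(1)] by (simp add: prob_compl algebra_simps)
  next
    case (union A)
    have Ai: "A i \<in> sets M" for i using union M by blast
    have "(\<lambda>i. prob (A i)) sums prob (\<Union>i. A i)"
      by (rule finite_measure_UNION) (use union Ai in auto)
    then have "(\<lambda>i. prob (A i) * prob ?E) sums (prob (\<Union>i. A i) * prob ?E)"
      by (rule sums_mult2)
    moreover have "(\<lambda>i. prob (A i \<inter> ?E)) sums prob (\<Union>i. A i \<inter> ?E)"
      by (rule finite_measure_UNION)
        (use union(1) Ai E in \<open>auto simp: disjoint_family_on_def\<close>)
    ultimately show ?case
      using union(3) by (simp add: sums_unique2)
  qed simp
qed

text \<open>Independence as a product law. The first component is the whole \<open>\<omega>\<close>,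
  seen through \<open>F s\<close>, so that Fubini's theorem applies to any number of
  \<open>F s\<close>-measurable functions at once.\<close>

lemma distr_pair_increment:
  assumes s: "0 \<le> s" "s < t" "t \<le> T"
  shows "restr_to_subalg M (F s) \<Otimes>\<^sub>M distr M borel (\<lambda>\<omega>. B t \<omega> - B s \<omega>)
    = distr M (restr_to_subalg M (F s) \<Otimes>\<^sub>M borel) (\<lambda>\<omega>. (\<omega>, B t \<omega> - B s \<omega>))"
proof (rule pair_measure_eqI)
  have sub: "subalgebra M (F s)" using s by (intro subalgebra_F) simp
  have [measurable]: "(\<lambda>\<omega>. B t \<omega> - B s \<omega>) \<in> borel_measurable M"
    using s by (intro measurable_increment) auto
  show "sigma_finite_measure (restr_to_subalg M (F s))"
    using finite_measure_restr_to_subalg[OF sub] finite_measure_axioms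
    by (simp add: finite_measure_def)
  show "sigma_finite_measure (distr M borel (\<lambda>\<omega>. B t \<omega> - B s \<omega>))"
    by (intro prob_space_imp_sigma_finite prob_space_distr) simp
  show "sets (restr_to_subalg M (F s) \<Otimes>\<^sub>M distr M borel (\<lambda>\<omega>. B t \<omega> - B s \<omega>)) =
      sets (distr M (restr_to_subalg M (F s) \<Otimes>\<^sub>M borel) (\<lambda>\<omega>. (\<omega>, B t \<omega> - B s \<omega>)))"
    by (simp cong: sets_pair_measure_cong)
  fix A U assume A: "A \<in> sets (restr_to_subalg M (F s))"
    and "U \<in> sets (distr M borel (\<lambda>\<omega>. B t \<omega> - B s \<omega>))"
  then have U: "U \<in> sets borel" by simp
  have AF: "A \<in> sets (F s)" using A by (simp add: sets_restr_to_subalg[OF sub])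
  have id: "(\<lambda>\<omega>. \<omega>) \<in> measurable M (restr_to_subalg M (F s))"
    using sub by (auto simp: measurable_def sets_restr_to_subalg space_restr_to_subalg subalgebra_def sets.Int_space_eq2)
  have eq: "(\<lambda>\<omega>. (\<omega>, B t \<omega> - B s \<omega>)) -` (A \<times> U) \<inter> space M
      = A \<inter> {\<omega> \<in> space M. B t \<omega> - B s \<omega> \<in> U}"
    by auto
  have "emeasure (distr M (restr_to_subalg M (F s) \<Otimes>\<^sub>M borel) (\<lambda>\<omega>. (\<omega>, B t \<omega> - B s \<omega>))) (A \<times> U)
      = emeasure M (A \<inter> {\<omega> \<in> space M. B t \<omega> - B s \<omega> \<in> U})"
    using A U id by (subst emeasure_distr) (auto simp: eq)
  also have "\<dots> = emeasure M A * emeasure M {\<omega> \<in> space M. B t \<omega> - B s \<omega> \<in> U}"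
    by (simp add: emeasure_eq_measure prob_F_increment[OF s AF U] ennreal_mult)
  also have "\<dots> = emeasure (restr_to_subalg M (F s)) A * emeasure (distr M borel (\<lambda>\<omega>. B t \<omega> - B s \<omega>)) U"
    using U by (simp add: emeasure_restr_to_subalg[OF sub AF] emeasure_distr vimage_def Int_def conj_commute)
  finally show "emeasure (restr_to_subalg M (F s)) A * emeasure (distr M borel (\<lambda>\<omega>. B t \<omega> - B s \<omega>)) U
     = emeasure (distr M (restr_to_subalg M (F s) \<Otimes>\<^sub>M borel) (\<lambda>\<omega>. (\<omega>, B t \<omega> - B s \<omega>))) (A \<times> U)" ..
qed

text \<open>For frozen \<open>\<omega>\<close> the inner integral over the increment is a normalised
  Gaussian exponential moment with the constant \<open>\<xi> \<omega>\<close>, hence equal to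
  1.\<close>

lemma nn_integral_exp_increment:
  assumes s: "0 \<le> s" "s < t" "t \<le> T"
    and f: "f \<in> borel_measurable (F s)" and \<xi>: "\<xi> \<in> borel_measurable (F s)"
  shows "(\<integral>\<^sup>+\<omega>. f \<omega> * ennreal (exp (\<xi> \<omega> * (B t \<omega> - B s \<omega>) - (\<xi> \<omega>)\<^sup>2 * (t - s) / 2)) \<partial>M)
    = (\<integral>\<^sup>+\<omega>. f \<omega> \<partial>M)"
proof -
  let ?R = "restr_to_subalg M (F s)" and ?N = "distr M borel (\<lambda>\<omega>. B t \<omega> - B s \<omega>)"
  have sub: "subalgebra M (F s)" using s by (intro subalgebra_F) simp
  have inc[measurable]: "(\<lambda>\<omega>. B t \<omega> - B s \<omega>) \<in> borel_measurable M"
    using s by (intro measurable_increment) auto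
  have [measurable]: "f \<in> borel_measurable ?R" "\<xi> \<in> borel_measurable ?R"
    using f \<xi> sub by (auto simp: measurable_def sets_restr_to_subalg space_restr_to_subalg)
  have id[measurable]: "(\<lambda>\<omega>. \<omega>) \<in> measurable M ?R"
    using sub by (auto simp: measurable_def sets_restr_to_subalg space_restr_to_subalg subalgebra_def sets.Int_space_eq2)
  interpret N: prob_space ?N by (rule prob_space_distr) simp
  have N: "?N = density lborel (\<lambda>x. ennreal (normal_density 0 (sqrt (t - s)) x))"
    using distributed_distr_eq_density[OF distributed_increment[OF s]]
    by (simp add: distr_cong[OF refl sets_lborel])
  let ?h = "\<lambda>\<omega> z. f \<omega> * ennreal (exp (\<xi> \<omega> * z - (\<xi> \<omega>)\<^sup>2 * (t - s) / 2))"
  have "(\<integral>\<^sup>+\<omega>. ?h \<omega> (B t \<omega> - B s \<omega>) \<partial>M)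
      = (\<integral>\<^sup>+p. ?h (fst p) (snd p) \<partial>distr M (?R \<Otimes>\<^sub>M borel) (\<lambda>\<omega>. (\<omega>, B t \<omega> - B s \<omega>)))"
    by (subst nn_integral_distr) auto
  also have "\<dots> = (\<integral>\<^sup>+p. ?h (fst p) (snd p) \<partial>(?R \<Otimes>\<^sub>M ?N))"
    by (simp add: distr_pair_increment[OF s])
  also have "\<dots> = (\<integral>\<^sup>+\<omega>. \<integral>\<^sup>+z. ?h \<omega> z \<partial>?N \<partial>?R)"
    by (subst N.nn_integral_fst[symmetric]) (auto cong: measurable_cong_sets sets_pair_measure_cong)
  also have "\<dots> = (\<integral>\<^sup>+\<omega>. f \<omega> \<partial>?R)"
  proof (rule nn_integral_cong)
    fix \<omega>
    have "(\<integral>\<^sup>+z. ?h \<omega> z \<partial>?N) = f \<omega> * (\<integral>\<^sup>+z. ennreal (exp (\<xi> \<omega> * z - (\<xi> \<omega>)\<^sup>2 * (t - s) / 2)) \<partial>?N)"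
      by (rule nn_integral_cmult) simp
    also have "(\<integral>\<^sup>+z. ennreal (exp (\<xi> \<omega> * z - (\<xi> \<omega>)\<^sup>2 * (t - s) / 2)) \<partial>?N) = 1"
      using nn_integral_exp_normal_density[of "t - s" "\<xi> \<omega>"] s
      unfolding N by (subst nn_integral_density) (auto simp: mult.commute)
    finally show "(\<integral>\<^sup>+z. ?h \<omega> z \<partial>?N) = f \<omega>" by simp
  qed
  also have "\<dots> = (\<integral>\<^sup>+\<omega>. f \<omega> \<partial>M)"
    by (rule nn_integral_subalgebra2[OF sub f])
  finally show ?thesis .
qed

end


section \<open>Simple processes\<close>

text \<open>By continuity a strict inequality at one time persists nearby, in particular at a dyadic
  multiple of \<open>h\<close>. This replaces uncountable unions over time by countable
  ones.\<close>

lemma dyadic_witness: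
  fixes f :: "real \<Rightarrow> real"
  assumes f: "continuous_on {0..h} f" and t: "t \<in> {0..h}" and y: "y < f t"
  obtains N j :: nat where "j \<le> 2 ^ N" "y < f (h * real j / 2 ^ N)"
proof (cases "h = 0")
  case True
  then show ?thesis using that[of 0 0] t y by simp
next
  case False
  with t have h: "h > 0" by auto
  obtain \<delta> where \<delta>: "\<delta> > 0" "\<And>u. u \<in> {0..h} \<Longrightarrow> \<bar>u - t\<bar> < \<delta> \<Longrightarrow> \<bar>f u - f t\<bar> < f t - y"
    using f t y unfolding continuous_on_iff dist_real_def by (meson diff_gt_0_iff_gt)
  obtain N where N: "(1/2) ^ N < \<delta> / h"
    using real_arch_pow_inv[of "\<delta> / h" "1/2"] h \<delta>(1) by auto
  \<comment> \<open>The level-\<open>N\<close> grid point immediately to the left of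
    \<open>t\<close>; it lies in \<open>{0..h}\<close> because \<open>t\<close> does.\<close>
  define j where "j = nat \<lfloor>t * 2 ^ N / h\<rfloor>"
  have "0 \<le> t * 2 ^ N / h" using t h by simp
  then have j: "real j \<le> t * 2 ^ N / h" "t * 2 ^ N / h < real j + 1"
    unfolding j_def by linarith+
  have le: "h * real j / 2 ^ N \<le> t" using j(1) h by (simp add: field_simps)
  have "t * 2 ^ N < h * (real j + 1)"
    using j(2) h by (simp add: pos_divide_less_eq mult.commute)
  then have "t < h * (real j + 1) / 2 ^ N"
    by (simp add: pos_less_divide_eq)
  also have "\<dots> = h * real j / 2 ^ N + h * (1/2) ^ N"
    by (simp add: power_one_over distrib_left add_divide_distrib)
  finally have "t - h * real j / 2 ^ N < h * (1/2) ^ N"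
    by simp
  also have "\<dots> < \<delta>" using N h by (simp add: pos_less_divide_eq mult.commute)
  finally have "\<bar>f (h * real j / 2 ^ N) - f t\<bar> < f t - y"
    using le t h by (intro \<delta>(2)) auto
  then have "y < f (h * real j / 2 ^ N)" by linarith
  moreover have "real j \<le> 2 ^ N"
  proof -
    have "t * 2 ^ N / h \<le> 2 ^ N" using t h by (simp add: field_simps)
    with j(1) show ?thesis by linarith
  qed
  then have "real j \<le> real (2 ^ N)" by simp
  then have "j \<le> 2 ^ N" by (simp only: of_nat_le_iff)
  ultimately show ?thesis by (rule that[rotated])
qed

lemma dyadic_bounds:
  fixes h :: real and j N :: nat
  assumes "0 \<le> h" "j \<le> 2 ^ N"
  shows "0 \<le> h * real j / 2 ^ N" "h * real j / 2 ^ N \<le> h"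
proof -
  have "real j \<le> real (2 ^ N)" using assms(2) by (simp only: of_nat_le_iff)
  then have "h * real j \<le> h * 2 ^ N" using assms(1) by (intro mult_left_mono) auto
  then show "h * real j / 2 ^ N \<le> h" by (simp add: field_simps)
qed (use assms in simp)

lemma grid_bounds:
  fixes s t :: real
  assumes "s \<le> t" "j \<le> Suc N"
  shows "s \<le> s + (t - s) * real j / real (Suc N)" "s + (t - s) * real j / real (Suc N) \<le> t"
proof -
  show "s \<le> s + (t - s) * real j / real (Suc N)" using assms by simp
  have "(t - s) * (real j / real (Suc N)) \<le> (t - s) * 1"
    using assms by (intro mult_left_mono) (auto simp: divide_le_eq_1)
  then show "s + (t - s) * real j / real (Suc N) \<le> t" by simp
qed

lemma step_mono_upto:
  fixes f :: "nat \<Rightarrow> 'a::preorder"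
  assumes step: "\<And>i. i < n \<Longrightarrow> f i \<le> f (Suc i)" and "i \<le> j" "j \<le> n"
  shows "f i \<le> f j"
  using assms(2,3)
proof (induction j rule: dec_induct)
  case (step j)
  then show ?case using assms(1)[of j] by (auto intro: order_trans)
qed simp

text \<open>Outside the measurable sets \<open>measure\<close> is 0 by convention, so convergence in
  probability carries information only once these events are measurable. Paths are continuous only
  almost surely; the event therefore agrees with a countable dyadic union up to a null set, and
  completeness does the rest.\<close>

lemma (in complete_measure) sets_SUP_continuous:
  fixes Z :: "real \<Rightarrow> 'a \<Rightarrow> real"
  assumes T: "0 \<le> T" and Z: "\<And>t. 0 \<le> t \<Longrightarrow> t \<le> T \<Longrightarrow> Z t \<in> borel_measurable M"
    and cont: "AE \<omega> in M. continuous_on {0..T} (\<lambda>t. Z t \<omega>)" and e: "0 \<le> e"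
  shows "{\<omega> \<in> space M. (SUP t\<in>{0..T}. ennreal \<bar>Z t \<omega>\<bar>) > ennreal e} \<in> sets M"
proof (rule in_sets_AE)
  let ?S = "\<Union>N. \<Union>j\<in>{..2^N}. {\<omega> \<in> space M. e < \<bar>Z (T * real j / 2 ^ N) \<omega>\<bar>}"
  note dy = dyadic_bounds[OF T]
  have "{\<omega> \<in> space M. e < \<bar>Z (T * real j / 2 ^ N) \<omega>\<bar>} \<in> sets M" if "j \<le> 2 ^ N" for j N :: nat
    using Z[OF dy[OF that]] by measurable
  then show "?S \<in> sets M" by auto
  show "AE \<omega> in M. \<omega> \<in> ?S \<longleftrightarrow> \<omega> \<in> {\<omega> \<in> space M. (SUP t\<in>{0..T}. ennreal \<bar>Z t \<omega>\<bar>) > ennreal e}"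
    using cont AE_space
  proof eventually_elim
    case (elim \<omega>)
    have cont': "continuous_on {0..T} (\<lambda>t. \<bar>Z t \<omega>\<bar>)" using elim by (intro continuous_intros)
    have "(\<exists>t\<in>{0..T}. e < \<bar>Z t \<omega>\<bar>) \<longleftrightarrow> (\<exists>N. \<exists>j\<in>{..2^N}. e < \<bar>Z (T * real j / 2 ^ N) \<omega>\<bar>)"
    proof safe
      fix t assume "t \<in> {0..T}" "e < \<bar>Z t \<omega>\<bar>"
      then obtain N j :: nat where "j \<le> 2 ^ N" "e < \<bar>Z (T * real j / 2 ^ N) \<omega>\<bar>"
        by (rule dyadic_witness[OF cont'])
      then show "\<exists>N. \<exists>j\<in>{..2^N}. e < \<bar>Z (T * real j / 2 ^ N) \<omega>\<bar>" by auto
    next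
      fix N j :: nat assume "j \<le> 2 ^ N" "e < \<bar>Z (T * real j / 2 ^ N) \<omega>\<bar>"
      then show "\<exists>t\<in>{0..T}. e < \<bar>Z t \<omega>\<bar>"
        using dy by (intro bexI[of _ "T * real j / 2 ^ N"]) auto
    qed
    then show ?case
      using e elim by (simp add: less_SUP_iff ennreal_less_iff Bex_def)
  qed
qed auto

lemma borel_measurable_set_nn_integral:
  assumes f: "(\<lambda>(s, \<omega>). f s \<omega>) \<in> borel_measurable (restrict_space borel {0..T} \<Otimes>\<^sub>M N)"
  shows "(\<lambda>\<omega>. \<integral>\<^sup>+s\<in>{0..T::real}. (f s \<omega> :: ennreal) \<partial>lborel) \<in> borel_measurable N"
proof -
  interpret R: sigma_finite_measure "restrict_space lborel {0..T}"
    by (rule sigma_finite_measure_restrict_space) (auto simp: lborel.sigma_finite_measure_axioms)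
  have [measurable]: "(\<lambda>(s, \<omega>). f s \<omega>) \<in> borel_measurable (restrict_space lborel {0..T} \<Otimes>\<^sub>M N)"
    using f by (simp cong: measurable_cong_sets sets_pair_measure_cong add: sets_restrict_space)
  have [measurable]: "(\<lambda>(\<omega>, s). f s \<omega>) \<in> borel_measurable (N \<Otimes>\<^sub>M restrict_space lborel {0..T})"
    by measurable
  have "(\<lambda>\<omega>. \<integral>\<^sup>+s. f s \<omega> \<partial>restrict_space lborel {0..T}) \<in> borel_measurable N"
    by (rule R.borel_measurable_nn_integral) simp
  then show ?thesis
    by (simp add: nn_integral_restrict_space)
qed

section \<open>Quadratic variation of simple integrals\<close>

definition clip :: "real \<Rightarrow> real \<Rightarrow> real \<Rightarrow> real" where
  "clip s t r = max s (min t r)"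

text \<open>The integral of the squared simple process over \<open>{s..t}\<close>, written as a
  finite sum over the clipped grid: intervals outside \<open>{s..t}\<close> collapse to points and
  contribute nothing.\<close>

definition simple_proc_variation :: "'a simple_proc \<Rightarrow> real \<Rightarrow> real \<Rightarrow> 'a \<Rightarrow> real" where
  "simple_proc_variation = (\<lambda>(n, \<tau>, \<xi>) s t \<omega>. \<Sum>i<n. (\<xi> i \<omega>)\<^sup>2 * (clip s t (\<tau> (Suc i)) - clip s t (\<tau> i)))"

lemma clip_mono: "r \<le> r' \<Longrightarrow> clip s t r \<le> clip s t r'"
  by (auto simp: clip_def)

text \<open>The grid intervals are disjoint, so at each time at most one summand is nonzero and the
  square of the sum is the sum of the squares. An upper bound suffices, as the variation enters
  later exponents with a negative sign.\<close>

lemma simple_proc_variation_le: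
  assumes S: "is_simple_proc M F T (n, \<tau>, \<xi>)" and s: "s \<le> t"
  shows "ennreal (simple_proc_variation (n, \<tau>, \<xi>) s t \<omega>)
    \<le> (\<integral>\<^sup>+r\<in>{s..t}. ennreal ((simple_proc_val (n, \<tau>, \<xi>) r \<omega>)\<^sup>2) \<partial>lborel)"
proof -
  have \<tau>: "\<tau> i \<le> \<tau> (Suc i)" if "i < n" for i
    using S that by (simp add: is_simple_proc_def)
  note \<tau>_mono = step_mono_upto[where f = \<tau>, OF \<tau>]
  have val: "(simple_proc_val (n, \<tau>, \<xi>) r \<omega>)\<^sup>2 = (\<Sum>i<n. (\<xi> i \<omega>)\<^sup>2 * indicator {\<tau> i<..\<tau> (Suc i)} r)" for r
  proof (cases "\<exists>i<n. r \<in> {\<tau> i<..\<tau> (Suc i)}")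
    case True
    then obtain i where i: "i < n" "r \<in> {\<tau> i<..\<tau> (Suc i)}" by blast
    have uniq: "indicator {\<tau> j<..\<tau> (Suc j)} r = (if j = i then 1 else 0 :: real)" if "j < n" for j
    proof (cases i j rule: linorder_cases)
      case less
      then have "\<tau> (Suc i) \<le> \<tau> j" using that by (intro \<tau>_mono) auto
      then show ?thesis using i less by simp
    next
      case greater
      then have "\<tau> (Suc j) \<le> \<tau> i" using i by (intro \<tau>_mono) auto
      then show ?thesis using i greater by simp
    qed (use i in simp)
    have "(\<Sum>j<n. c j * indicator {\<tau> j<..\<tau> (Suc j)} r) = c i" for c :: "nat \<Rightarrow> real"
    proof -
      have "(\<Sum>j<n. c j * indicator {\<tau> j<..\<tau> (Suc j)} r) = (\<Sum>j<n. if j = i then c i else 0)"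
        by (rule sum.cong) (simp_all add: uniq del: indicator_simps)
      then show ?thesis using i(1) by simp
    qed
    then show ?thesis by (simp add: simple_proc_val_def)
  next
    case False
    then have "(\<Sum>j<n. c j * indicator {\<tau> j<..\<tau> (Suc j)} r) = 0" for c :: "nat \<Rightarrow> real"
      by (intro sum.neutral) auto
    then show ?thesis by (simp add: simple_proc_val_def)
  qed
  have sub: "{clip s t (\<tau> i)<..clip s t (\<tau> (Suc i))} \<subseteq> {\<tau> i<..\<tau> (Suc i)} \<inter> {s..t}" for i
    using s by (auto simp: clip_def max_def min_def split: if_splits)
  have "ennreal (simple_proc_variation (n, \<tau>, \<xi>) s t \<omega>)
      = (\<Sum>i<n. ennreal ((\<xi> i \<omega>)\<^sup>2) * emeasure lborel {clip s t (\<tau> i)<..clip s t (\<tau> (Suc i))})"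
    unfolding simple_proc_variation_def prod.case
    by (subst sum_ennreal[symmetric]) (auto simp: ennreal_mult clip_mono \<tau> intro!: sum.cong)
  also have "\<dots> = (\<integral>\<^sup>+r. (\<Sum>i<n. ennreal ((\<xi> i \<omega>)\<^sup>2) * indicator {clip s t (\<tau> i)<..clip s t (\<tau> (Suc i))} r) \<partial>lborel)"
    by (subst nn_integral_sum) (auto simp: nn_integral_cmult_indicator)
  also have "\<dots> \<le> (\<integral>\<^sup>+r\<in>{s..t}. ennreal ((simple_proc_val (n, \<tau>, \<xi>) r \<omega>)\<^sup>2) \<partial>lborel)"
  proof (rule nn_integral_mono)
    fix r
    have "(\<Sum>i<n. ennreal ((\<xi> i \<omega>)\<^sup>2) * indicator {clip s t (\<tau> i)<..clip s t (\<tau> (Suc i))} r)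
        \<le> (\<Sum>i<n. ennreal ((\<xi> i \<omega>)\<^sup>2) * indicator ({\<tau> i<..\<tau> (Suc i)} \<inter> {s..t}) r)"
      by (intro sum_mono mult_left_mono indicator_leI subsetD[OF sub]) auto
    also have "\<dots> = (\<Sum>i<n. ennreal ((\<xi> i \<omega>)\<^sup>2 * indicator {\<tau> i<..\<tau> (Suc i)} r)) * indicator {s..t} r"
      unfolding sum_distrib_right by (rule sum.cong) (auto split: split_indicator)
    also have "\<dots> = ennreal ((simple_proc_val (n, \<tau>, \<xi>) r \<omega>)\<^sup>2) * indicator {s..t} r"
      unfolding val by (subst sum_ennreal) auto
    finally show "(\<Sum>i<n. ennreal ((\<xi> i \<omega>)\<^sup>2) * indicator {clip s t (\<tau> i)<..clip s t (\<tau> (Suc i))} r)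
        \<le> ennreal ((simple_proc_val (n, \<tau>, \<xi>) r \<omega>)\<^sup>2) * indicator {s..t} r" .
  qed
  finally show ?thesis .
qed

section \<open>Exponential martingales of simple integrals\<close>

context brownian
begin

text \<open>Induction along the clipped grid: the partial product \<open>K k\<close> is known at
  time \<open>u k\<close>, and the next Gaussian factor integrates to 1 against it.\<close>

lemma nn_integral_exp_simple:
  assumes S: "is_simple_proc M F T (n, \<tau>, \<xi>)" and st: "0 \<le> s" "s \<le> t" "t \<le> T" and A: "A \<in> sets (F s)"
  shows "(\<integral>\<^sup>+\<omega>. indicator A \<omega> * ennreal (exp (g * (simple_proc_integral B (n, \<tau>, \<xi>) t \<omega>
      - simple_proc_integral B (n, \<tau>, \<xi>) s \<omega>) - g\<^sup>2 / 2 * simple_proc_variation (n, \<tau>, \<xi>) s t \<omega>)) \<partial>M)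
    = emeasure M A"
proof -
  define u where "u i = clip s t (\<tau> i)" for i
  have \<tau>: "\<tau> i \<le> \<tau> (Suc i)" if "i < n" for i
    using S that by (simp add: is_simple_proc_def)
  have u: "s \<le> u i" "u i \<le> t" for i
    using st by (auto simp: u_def clip_def)
  have uS: "u i \<le> u (Suc i)" if "i < n" for i
    using \<tau>[OF that] by (simp add: u_def clip_mono)
  \<comment> \<open>If \<open>\<tau> i\<close> lies beyond \<open>t\<close>, then
    \<open>u i = t\<close> and \<open>\<xi> i\<close> need not be measurable for
    \<open>F (u i)\<close>. Setting it to 0 on degenerate intervals restores adaptedness and changes
    neither of the two sums.\<close>
  define \<eta> where "\<eta> i = (if u i < u (Suc i) then \<xi> i else (\<lambda>_. 0))" for i
  have \<eta>: "\<eta> i \<in> borel_measurable (F (u i))" if "i < n" for i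
  proof (cases "u i < u (Suc i)")
    case True
    then have "\<tau> i \<le> u i" using st by (auto simp: u_def clip_def max_def min_def split: if_splits)
    moreover have "\<xi> i \<in> borel_measurable (F (\<tau> i))"
      using S that by (simp add: is_simple_proc_def)
    ultimately show ?thesis using True by (simp add: \<eta>_def measurable_F_mono)
  qed (simp add: \<eta>_def)
  define L where "L i \<omega> = g * (\<eta> i \<omega> * (B (u (Suc i)) \<omega> - B (u i) \<omega>)) - g\<^sup>2 / 2 * ((\<eta> i \<omega>)\<^sup>2 * (u (Suc i) - u i))" for i \<omega>
  define K where "K k \<omega> = indicator A \<omega> * ennreal (exp (\<Sum>i<k. L i \<omega>))" for k \<omega>
  have L: "L i \<in> borel_measurable (F (u k))" if "i < k" "k \<le> n" for i k
  proof -
    have "u (Suc i) \<le> u k"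
      using that by (intro step_mono_upto[where f = u and n = n, OF uS]) auto
    moreover have "u i \<le> u k" using calculation uS[of i] that by auto
    moreover have "\<eta> i \<in> borel_measurable (F (u k))"
      using \<eta>[of i] \<open>u i \<le> u k\<close> that by (auto intro: measurable_F_mono)
    moreover have "0 \<le> u j" for j using u(1)[of j] st by simp
    ultimately show ?thesis
      unfolding L_def
      by (intro borel_measurable_diff borel_measurable_times borel_measurable_const borel_measurable_power adapted_B) auto
  qed
  have K: "K k \<in> borel_measurable (F (u k))" if "k \<le> n" for k
  proof -
    have [measurable]: "A \<in> sets (F (u k))" using A sets_F_mono[OF u(1)[of k]] by auto
    have [measurable]: "(\<lambda>\<omega>. \<Sum>i<k. L i \<omega>) \<in> borel_measurable (F (u k))"
      using that by (intro borel_measurable_sum L) auto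
    show ?thesis unfolding K_def by measurable
  qed
  have "(\<integral>\<^sup>+\<omega>. K k \<omega> \<partial>M) = emeasure M A" if "k \<le> n" for k
    using that
  proof (induction k)
    case 0
    then show ?case
      using A sets_F_subset[of s] st by (auto simp: K_def)
  next
    case (Suc k)
    have step: "K (Suc k) \<omega> = K k \<omega> * ennreal (exp (L k \<omega>))" for \<omega>
      by (simp add: K_def exp_add ennreal_mult mult.assoc)
    show ?case
    proof (cases "u k < u (Suc k)")
      case True
      have L_eq: "L k \<omega> = (g * \<eta> k \<omega>) * (B (u (Suc k)) \<omega> - B (u k) \<omega>) - (g * \<eta> k \<omega>)\<^sup>2 * (u (Suc k) - u k) / 2" for \<omega>
        by (simp add: L_def power_mult_distrib)
      have "(\<integral>\<^sup>+\<omega>. K (Suc k) \<omega> \<partial>M) = (\<integral>\<^sup>+\<omega>. K k \<omega> \<partial>M)"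
        unfolding step L_eq
        by (rule nn_integral_exp_increment)
          (use True u[of k] u[of "Suc k"] st Suc.prems K \<eta> in \<open>auto intro!: borel_measurable_times\<close>)
      then show ?thesis using Suc by simp
    next
      case False
      then have "u (Suc k) = u k" using uS[of k] Suc.prems by simp
      then have "L k \<omega> = 0" for \<omega> by (simp add: L_def)
      then show ?thesis using Suc unfolding step by simp
    qed
  qed
  from this[of n] have main: "(\<integral>\<^sup>+\<omega>. K n \<omega> \<partial>M) = emeasure M A" by simp
  have \<eta>_eq: "\<eta> i \<omega> * (B (u (Suc i)) \<omega> - B (u i) \<omega>) = \<xi> i \<omega> * (B (u (Suc i)) \<omega> - B (u i) \<omega>)"
    "(\<eta> i \<omega>)\<^sup>2 * (u (Suc i) - u i) = (\<xi> i \<omega>)\<^sup>2 * (u (Suc i) - u i)" if "i < n" for i \<omega>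
    using uS[OF that] by (auto simp: \<eta>_def)
  \<comment> \<open>Subtracting the path stopped at \<open>s\<close> from the path stopped at
    \<open>t\<close> leaves the path on \<open>{s..t}\<close> up to the constant \<open>B s\<close>,
    which cancels over each grid interval.\<close>
  have clip: "B (min t r) \<omega> - B (min s r) \<omega> = B (clip s t r) \<omega> - B s \<omega>" for r \<omega>
    using st by (auto simp: clip_def max_def min_def)
  have "simple_proc_integral B (n, \<tau>, \<xi>) t \<omega> - simple_proc_integral B (n, \<tau>, \<xi>) s \<omega>
      = (\<Sum>i<n. \<xi> i \<omega> * ((B (min t (\<tau> (Suc i))) \<omega> - B (min s (\<tau> (Suc i))) \<omega>) - (B (min t (\<tau> i)) \<omega> - B (min s (\<tau> i)) \<omega>)))" for \<omega>
    by (simp add: simple_proc_integral_def sum_subtractf[symmetric] algebra_simps)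
  then have int: "simple_proc_integral B (n, \<tau>, \<xi>) t \<omega> - simple_proc_integral B (n, \<tau>, \<xi>) s \<omega>
      = (\<Sum>i<n. \<eta> i \<omega> * (B (u (Suc i)) \<omega> - B (u i) \<omega>))" for \<omega>
    unfolding clip by (simp add: \<eta>_eq u_def[symmetric])
  have var: "simple_proc_variation (n, \<tau>, \<xi>) s t \<omega> = (\<Sum>i<n. (\<eta> i \<omega>)\<^sup>2 * (u (Suc i) - u i))" for \<omega>
    by (simp add: simple_proc_variation_def u_def[symmetric] \<eta>_eq)
  show ?thesis
    unfolding int var using main
    by (simp add: K_def L_def sum_subtractf sum_distrib_left)
qed

lemma simple_proc_grid:
  assumes S: "is_simple_proc M F T (n, \<tau>, \<xi>)" and "i \<le> n"
  shows "0 \<le> \<tau> i" "\<tau> i \<le> T"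
proof -
  have step: "\<tau> i \<le> \<tau> (Suc i)" if "i < n" for i
    using S that by (simp add: is_simple_proc_def)
  show "0 \<le> \<tau> i"
    using assms by (induction i) (auto simp: is_simple_proc_def intro: order_trans)
  have "\<tau> i \<le> \<tau> n"
    using \<open>i \<le> n\<close> by (intro step_mono_upto[where f = \<tau>, OF step]) auto
  then show "\<tau> i \<le> T" using S by (simp add: is_simple_proc_def)
qed

lemma simple_proc_integral_continuous:
  assumes S: "is_simple_proc M F T (n, \<tau>, \<xi>)" and B: "continuous_on {0..T} (\<lambda>t. B t \<omega>)"
  shows "continuous_on {0..T} (\<lambda>t. simple_proc_integral B (n, \<tau>, \<xi>) t \<omega>)"
proof -
  have "continuous_on {0..T} (\<lambda>t. B (min t (\<tau> i)) \<omega>)" if "i \<le> n" for i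
    by (rule continuous_on_compose2[OF B]) (use simple_proc_grid(1)[OF S that] in \<open>auto intro!: continuous_intros\<close>)
  then show ?thesis
    unfolding simple_proc_integral_def split_beta fst_conv snd_conv by (intro continuous_intros) auto
qed

lemma simple_proc_integral_measurable:
  assumes S: "is_simple_proc M F T (n, \<tau>, \<xi>)" and t: "0 \<le> t" "t \<le> T"
  shows "simple_proc_integral B (n, \<tau>, \<xi>) t \<in> borel_measurable M"
proof -
  have "\<xi> i \<in> borel_measurable M" if "i < n" for i
    using S that simple_proc_grid[OF S, of i] by (auto simp: is_simple_proc_def intro: measurable_F_M)
  moreover have "B (min t (\<tau> i)) \<in> borel_measurable M" if "i \<le> n" for i
    using t simple_proc_grid[OF S that] by (intro measurable_B) auto
  ultimately show ?thesis
    unfolding simple_proc_integral_def split_beta fst_conv snd_conv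
    by (intro borel_measurable_sum borel_measurable_times borel_measurable_diff) auto
qed

end


section \<open>Exponentials of Ito integrals\<close>

text \<open>Young's inequality for the cross term of \<open>u = v + (u - v)\<close>, weighted so
  that the factor of \<open>v\<^sup>2\<close> is as close to 1 as desired, at the expense of the
  error term.\<close>

lemma power2_le_split:
  fixes u v d :: real
  assumes "d > 0"
  shows "u\<^sup>2 \<le> (1 + d) * v\<^sup>2 + (1 + 1 / d) * (u - v)\<^sup>2"
proof -
  have "0 \<le> (d * v - (u - v))\<^sup>2 / d" using assms by simp
  also have "\<dots> = (1 + d) * v\<^sup>2 + (1 + 1 / d) * (u - v)\<^sup>2 - u\<^sup>2"
    using assms by (simp add: field_simps power2_eq_square)
  finally show ?thesis by simp
qed

lemma nn_integral_power2_le_split: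
  fixes u v :: "real \<Rightarrow> real" and d :: real
  assumes d: "d > 0" and [measurable]: "A \<in> sets M"
    and v [measurable]: "v \<in> borel_measurable (restrict_space M A)"
    and u [measurable]: "u \<in> borel_measurable (restrict_space M A)"
  shows "(\<integral>\<^sup>+r\<in>A. ennreal ((u r)\<^sup>2) \<partial>M)
    \<le> ennreal (1 + d) * (\<integral>\<^sup>+r\<in>A. ennreal ((v r)\<^sup>2) \<partial>M) + ennreal (1 + 1 / d) * (\<integral>\<^sup>+r\<in>A. ennreal ((u r - v r)\<^sup>2) \<partial>M)"
proof -
  have A: "A \<inter> space M \<in> sets M" by simp
  have "(\<integral>\<^sup>+r. ennreal ((u r)\<^sup>2) \<partial>restrict_space M A)
      \<le> (\<integral>\<^sup>+r. ennreal (1 + d) * ennreal ((v r)\<^sup>2) + ennreal (1 + 1 / d) * ennreal ((u r - v r)\<^sup>2) \<partial>restrict_space M A)"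
    using power2_le_split[OF d] d
    by (intro nn_integral_mono) (simp add: ennreal_mult[symmetric] ennreal_plus[symmetric] del: ennreal_plus)
  also have "\<dots> = ennreal (1 + d) * (\<integral>\<^sup>+r. ennreal ((v r)\<^sup>2) \<partial>restrict_space M A)
      + ennreal (1 + 1 / d) * (\<integral>\<^sup>+r. ennreal ((u r - v r)\<^sup>2) \<partial>restrict_space M A)"
    by (subst nn_integral_add) (auto simp: nn_integral_cmult)
  finally show ?thesis
    by (simp add: nn_integral_restrict_space[OF A])
qed

section \<open>Passage from simple integrals to Ito integrals\<close>

context brownian
begin

lemma simple_proc_val_measurable:
  assumes S: "is_simple_proc M F T (n, \<tau>, \<xi>)"
  shows "(\<lambda>(s, \<omega>). simple_proc_val (n, \<tau>, \<xi>) s \<omega>) \<in> borel_measurable (restrict_space borel {0..T} \<Otimes>\<^sub>M F T)"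
proof -
  have [measurable]: "\<xi> i \<in> borel_measurable (F T)" if "i < n" for i
    using S that simple_proc_grid[OF S, of i] by (auto simp: is_simple_proc_def intro: measurable_F_mono)
  have [measurable]: "(\<lambda>x. x) \<in> borel_measurable (restrict_space borel {0..T})"
    by (rule measurable_restrict_space1) simp
  show ?thesis
    unfolding simple_proc_val_def split_beta fst_conv snd_conv
    by measurable
qed

lemma prog_measurable_path:
  assumes "prog_measurable F T H" "0 \<le> T" "\<omega> \<in> space M"
  shows "(\<lambda>s. H s \<omega>) \<in> borel_measurable (restrict_space borel {0..T})"
proof -
  have "(\<lambda>(s, \<omega>). H s \<omega>) \<in> borel_measurable (restrict_space borel {0..T} \<Otimes>\<^sub>M F T)"
    using assms by (auto simp: prog_measurable_def)
  from measurable_compose[OF _ this, of "\<lambda>s. (s, \<omega>)"] assms(3) show ?thesis by simp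
qed

text \<open>Turns the two limits in probability into deterministic pathwise bounds on measurable
  events whose probability tends to 1. Suprema over time and their measurability do not occur after
  this point of the approximation.\<close>

lemma ito_approximation_events:
  assumes complete: "complete_measure M" and ito: "has_ito_integral M T B H I" and T: "0 \<le> T"
  shows "\<exists>n \<tau> \<xi> G. (\<forall>k. is_simple_proc M F T (n k, \<tau> k, \<xi> k)) \<and>
    (\<forall>k e. 0 < e \<longrightarrow> G k e \<in> sets M) \<and>
    (\<forall>e. 0 < e \<longrightarrow> (\<lambda>k. prob (space M - G k e)) \<longlonglongrightarrow> 0) \<and>
    (\<forall>k e \<omega>. \<omega> \<in> G k e \<longrightarrow>
      (\<integral>\<^sup>+s\<in>{0..T}. ennreal ((simple_proc_val (n k, \<tau> k, \<xi> k) s \<omega> - H s \<omega>)\<^sup>2) \<partial>lborel) \<le> ennreal e) \<and>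
    (\<forall>k e \<omega> t. 0 \<le> e \<longrightarrow> \<omega> \<in> G k e \<longrightarrow> t \<in> {0..T} \<longrightarrow>
      \<bar>simple_proc_integral B (n k, \<tau> k, \<xi> k) t \<omega> - I t \<omega>\<bar> \<le> e)"
proof -
  from ito obtain S where S: "\<And>n. is_simple_proc M F T (S n)"
    and lim1: "tendsto_zero_in_prob M (\<lambda>n \<omega>. \<integral>\<^sup>+s\<in>{0..T}. ennreal ((simple_proc_val (S n) s \<omega> - H s \<omega>)\<^sup>2) \<partial>lborel)"
    and lim2: "tendsto_zero_in_prob M (\<lambda>n \<omega>. SUP t\<in>{0..T}. ennreal \<bar>simple_proc_integral B (S n) t \<omega> - I t \<omega>\<bar>)"
    and prog: "prog_measurable F T H" and adap: "adapted_to F T I"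
    and cont: "AE \<omega> in M. continuous_on {0..T} (\<lambda>t. I t \<omega>)"
    unfolding has_ito_integral_def by blast
  define n \<tau> \<xi> where "n k = fst (S k)" "\<tau> k = fst (snd (S k))" "\<xi> k = snd (snd (S k))" for k
  have S_eq: "S k = (n k, \<tau> k, \<xi> k)" for k by (simp add: n_\<tau>_\<xi>_def)
  note simple = S[unfolded S_eq]
  define Y1 where "Y1 k \<omega> = (\<integral>\<^sup>+s\<in>{0..T}. ennreal ((simple_proc_val (S k) s \<omega> - H s \<omega>)\<^sup>2) \<partial>lborel)" for k \<omega>
  define Y2 where "Y2 k \<omega> = (SUP t\<in>{0..T}. ennreal \<bar>simple_proc_integral B (S k) t \<omega> - I t \<omega>\<bar>)" for k \<omega>
  define G where "G k e = {\<omega> \<in> space M. Y1 k \<omega> \<le> ennreal e \<and> Y2 k \<omega> \<le> ennreal e}" for k e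
  have Y1: "{\<omega> \<in> space M. Y1 k \<omega> > ennreal e} \<in> sets M" for k e
  proof -
    have "(\<lambda>(s, \<omega>). H s \<omega>) \<in> borel_measurable (restrict_space borel {0..T} \<Otimes>\<^sub>M F T)"
      using prog T by (auto simp: prog_measurable_def)
    with simple_proc_val_measurable[OF simple[of k]]
    have "(\<lambda>(s, \<omega>). ennreal ((simple_proc_val (S k) s \<omega> - H s \<omega>)\<^sup>2)) \<in> borel_measurable (restrict_space borel {0..T} \<Otimes>\<^sub>M F T)"
      unfolding S_eq split_beta by measurable
    from borel_measurable_set_nn_integral[OF this]
    have "Y1 k \<in> borel_measurable M"
      unfolding Y1_def by (rule measurable_F_M) simp
    then show ?thesis by measurable
  qed
  have Y2: "{\<omega> \<in> space M. Y2 k \<omega> > ennreal e} \<in> sets M" if "0 \<le> e" for k e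
    unfolding Y2_def
  proof (rule complete_measure.sets_SUP_continuous[OF complete T _ _ that])
    fix t assume t: "0 \<le> t" "t \<le> T"
    then have "I t \<in> borel_measurable M"
      using adap by (auto simp: adapted_to_def intro: measurable_F_M)
    with simple_proc_integral_measurable[OF simple[of k] t]
    show "(\<lambda>\<omega>. simple_proc_integral B (S k) t \<omega> - I t \<omega>) \<in> borel_measurable M"
      unfolding S_eq by measurable
  next
    show "AE \<omega> in M. continuous_on {0..T} (\<lambda>t. simple_proc_integral B (S k) t \<omega> - I t \<omega>)"
      using cont AE_continuous_B
    proof eventually_elim
      case (elim \<omega>)
      then show ?case
        using simple_proc_integral_continuous[OF simple[of k] elim(2)]
        unfolding S_eq by (intro continuous_on_diff)
    qed
  qed
  have compl: "space M - G k e = {\<omega> \<in> space M. Y1 k \<omega> > ennreal e} \<union> {\<omega> \<in> space M. Y2 k \<omega> > ennreal e}" for k e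
    by (auto simp: G_def not_le)
  show ?thesis
  proof (intro exI[of _ n] exI[of _ \<tau>] exI[of _ \<xi>] exI[of _ G] conjI allI impI)
    fix k e assume e: "0 < (e::real)"
    have "G k e = space M - ({\<omega> \<in> space M. Y1 k \<omega> > ennreal e} \<union> {\<omega> \<in> space M. Y2 k \<omega> > ennreal e})"
      by (auto simp: G_def not_le)
    then show "G k e \<in> sets M" using Y1 Y2[of e] e by auto
  next
    fix e assume e: "0 < (e::real)"
    let ?p = "\<lambda>k. prob {\<omega> \<in> space M. Y1 k \<omega> > ennreal e} + prob {\<omega> \<in> space M. Y2 k \<omega> > ennreal e}"
    have "(\<lambda>k. prob {\<omega> \<in> space M. Y1 k \<omega> > ennreal e}) \<longlonglongrightarrow> 0"
      "(\<lambda>k. prob {\<omega> \<in> space M. Y2 k \<omega> > ennreal e}) \<longlonglongrightarrow> 0"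
      using lim1 lim2 e by (auto simp: tendsto_zero_in_prob_def Y1_def Y2_def)
    from tendsto_add[OF this] have p: "?p \<longlonglongrightarrow> 0" by simp
    show "(\<lambda>k. prob (space M - G k e)) \<longlonglongrightarrow> 0"
    proof (rule tendsto_sandwich[OF _ _ tendsto_const p])
      show "\<forall>\<^sub>F k in sequentially. prob (space M - G k e) \<le> ?p k"
        unfolding compl using Y1 Y2[of e] e
        by (intro always_eventually allI measure_Un_le) auto
    qed simp
  next
    fix k e \<omega> assume "\<omega> \<in> G k e"
    then show "(\<integral>\<^sup>+s\<in>{0..T}. ennreal ((simple_proc_val (n k, \<tau> k, \<xi> k) s \<omega> - H s \<omega>)\<^sup>2) \<partial>lborel) \<le> ennreal e"
      by (simp add: G_def Y1_def S_eq)
  next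
    fix k e \<omega> t assume *: "0 \<le> e" "\<omega> \<in> G k e" "t \<in> {0..T}"
    have "ennreal \<bar>simple_proc_integral B (n k, \<tau> k, \<xi> k) t \<omega> - I t \<omega>\<bar> \<le> Y2 k \<omega>"
      unfolding Y2_def S_eq by (rule SUP_upper) (fact *(3))
    also have "\<dots> \<le> ennreal e" using *(2) by (simp add: G_def)
    finally show "\<bar>simple_proc_integral B (n k, \<tau> k, \<xi> k) t \<omega> - I t \<omega>\<bar> \<le> e"
      using *(1) by simp
  qed (rule simple)
qed

text \<open>\<open>has_ito_integral\<close> does not prescribe the initial value. It is forced by
  the approximation, which is uniform on \<open>{0..T}\<close> and hence includes time 0, where all
  simple integrals vanish.\<close>

lemma AE_ito_integral_0:
  assumes complete: "complete_measure M" and ito: "has_ito_integral M T B H I" and T: "0 \<le> T"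
  shows "AE \<omega> in M. I 0 \<omega> = 0"
proof -
  obtain n \<tau> \<xi> G where *: "\<forall>k. is_simple_proc M F T (n k, \<tau> k, \<xi> k)"
    "\<forall>k e. 0 < e \<longrightarrow> G k e \<in> sets M"
    "\<forall>e. 0 < e \<longrightarrow> (\<lambda>k. prob (space M - G k e)) \<longlonglongrightarrow> 0"
    "\<forall>k e \<omega>. \<omega> \<in> G k e \<longrightarrow>
      (\<integral>\<^sup>+s\<in>{0..T}. ennreal ((simple_proc_val (n k, \<tau> k, \<xi> k) s \<omega> - H s \<omega>)\<^sup>2) \<partial>lborel) \<le> ennreal e"
    "\<forall>k e \<omega> t. 0 \<le> e \<longrightarrow> \<omega> \<in> G k e \<longrightarrow> t \<in> {0..T} \<longrightarrow>
      \<bar>simple_proc_integral B (n k, \<tau> k, \<xi> k) t \<omega> - I t \<omega>\<bar> \<le> e"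
    using ito_approximation_events[OF complete ito T] by (elim exE conjE)
  note S = *(1)[rule_format] and G = *(2,3)[rule_format] and Gv = *(4)[rule_format] and Gi = *(5)[rule_format]
  have zero: "simple_proc_integral B (n k, \<tau> k, \<xi> k) 0 \<omega> = 0" for k \<omega>
    using simple_proc_grid(1)[OF S[of k]] by (auto simp: simple_proc_integral_def min_def)
  have I: "I 0 \<in> borel_measurable M"
    using ito T by (auto simp: has_ito_integral_def adapted_to_def intro: measurable_F_M)
  have "AE \<omega> in M. \<bar>I 0 \<omega>\<bar> \<le> e" if e: "0 < e" for e
  proof -
    have "prob {\<omega> \<in> space M. \<not> \<bar>I 0 \<omega>\<bar> \<le> e} \<le> prob (space M - G k e)" for k
      using Gi[of e _ k 0] e T G(1)[OF e, of k]
      by (intro finite_measure_mono) (auto simp: zero)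
    then have "prob {\<omega> \<in> space M. \<not> \<bar>I 0 \<omega>\<bar> \<le> e} \<le> 0"
      using G(2)[OF e] by (intro LIMSEQ_le_const) auto
    then have "{\<omega> \<in> space M. \<not> \<bar>I 0 \<omega>\<bar> \<le> e} \<in> null_sets M"
      using I by (auto simp: null_sets_def emeasure_eq_measure measure_le_0_iff)
    then show ?thesis by (rule AE_I') auto
  qed
  then have "AE \<omega> in M. \<forall>k::nat. \<bar>I 0 \<omega>\<bar> \<le> inverse (real (Suc k))"
    by (simp add: AE_all_countable)
  then show ?thesis
  proof eventually_elim
    case (elim \<omega>)
    have "\<bar>I 0 \<omega>\<bar> \<le> 0"
      by (rule LIMSEQ_le_const[OF LIMSEQ_inverse_real_of_nat]) (use elim in auto)
    then show ?case by simp
  qed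
qed

text \<open>On an event \<open>G k e\<close> of probability close to one the integrals of the simple process and of \<open>H\<close>
  are comparable up to \<open>e\<close>; truncating at \<open>C\<close> makes the complement of the event negligible.\<close>

lemma nn_integral_exp_ito_truncated:
  assumes complete: "complete_measure M" and ito: "has_ito_integral M T B H I"
    and st: "0 \<le> s" "s \<le> t" "t \<le> T" and A: "A \<in> sets (F s)"
    and q: "q \<in> borel_measurable M" "AE \<omega> in M. 0 \<le> q \<omega> \<and> (\<integral>\<^sup>+r\<in>{s..t}. ennreal ((H r \<omega>)\<^sup>2) \<partial>lborel) \<le> ennreal (q \<omega>)"
    and d: "0 < d" and C: "0 \<le> C"
  shows "(\<integral>\<^sup>+\<omega>. indicator A \<omega> * ennreal (min C (exp (g * (I t \<omega> - I s \<omega>) - g\<^sup>2 / 2 * ((1 + d) * q \<omega>)))) \<partial>M)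
    \<le> emeasure M A"
proof -
  have T: "0 \<le> T" using st by simp
  obtain n \<tau> \<xi> G where *: "\<forall>k. is_simple_proc M F T (n k, \<tau> k, \<xi> k)"
    "\<forall>k e. 0 < e \<longrightarrow> G k e \<in> sets M"
    "\<forall>e. 0 < e \<longrightarrow> (\<lambda>k. prob (space M - G k e)) \<longlonglongrightarrow> 0"
    "\<forall>k e \<omega>. \<omega> \<in> G k e \<longrightarrow>
      (\<integral>\<^sup>+s\<in>{0..T}. ennreal ((simple_proc_val (n k, \<tau> k, \<xi> k) s \<omega> - H s \<omega>)\<^sup>2) \<partial>lborel) \<le> ennreal e"
    "\<forall>k e \<omega> t. 0 \<le> e \<longrightarrow> \<omega> \<in> G k e \<longrightarrow> t \<in> {0..T} \<longrightarrow>
      \<bar>simple_proc_integral B (n k, \<tau> k, \<xi> k) t \<omega> - I t \<omega>\<bar> \<le> e"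
    using ito_approximation_events[OF complete ito T] by (elim exE conjE)
  note S = *(1)[rule_format] and G = *(2,3)[rule_format] and Gv = *(4)[rule_format] and Gi = *(5)[rule_format]
  have prog: "prog_measurable F T H" using ito by (simp add: has_ito_integral_def)
  have [measurable]: "I t \<in> borel_measurable M" "I s \<in> borel_measurable M"
    using ito st by (auto simp: has_ito_integral_def adapted_to_def intro!: measurable_F_M)
  note [measurable] = q(1)
  have AM [measurable]: "A \<in> sets M" using A sets_F_subset[of s] st by auto
  define f where "f \<omega> = exp (g * (I t \<omega> - I s \<omega>) - g\<^sup>2 / 2 * ((1 + d) * q \<omega>))" for \<omega>
  have [measurable]: "f \<in> borel_measurable M" unfolding f_def by measurable
  \<comment> \<open>The total error in the exponent: \<open>e\<close> at each of the two times for
    the integral, and the remainder of the weighted square inequality for the quadratic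
    variation.\<close>
  define c where "c e = 2 * \<bar>g\<bar> * e + g\<^sup>2 / 2 * ((1 + 1 / d) * e)" for e
  define R where "R k \<omega> = exp (g * (simple_proc_integral B (n k, \<tau> k, \<xi> k) t \<omega> - simple_proc_integral B (n k, \<tau> k, \<xi> k) s \<omega>)
      - g\<^sup>2 / 2 * simple_proc_variation (n k, \<tau> k, \<xi> k) s t \<omega>)" for k \<omega>
  have R_int: "(\<integral>\<^sup>+\<omega>. indicator A \<omega> * ennreal (R k \<omega>) \<partial>M) = emeasure M A" for k
    unfolding R_def by (rule nn_integral_exp_simple[OF S st A])
  have R_meas [measurable]: "R k \<in> borel_measurable M" for k
  proof -
    have [measurable]: "\<xi> k i \<in> borel_measurable M" if "i < n k" for i
      using S[of k] that simple_proc_grid[OF S[of k], of i] by (auto simp: is_simple_proc_def intro: measurable_F_M)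
    have [measurable]: "simple_proc_integral B (n k, \<tau> k, \<xi> k) t \<in> borel_measurable M"
      "simple_proc_integral B (n k, \<tau> k, \<xi> k) s \<in> borel_measurable M"
      using st by (auto intro!: simple_proc_integral_measurable[OF S])
    have [measurable]: "simple_proc_variation (n k, \<tau> k, \<xi> k) s t \<in> borel_measurable M"
      unfolding simple_proc_variation_def prod.case by measurable
    show ?thesis unfolding R_def by measurable
  qed
  have pt: "AE \<omega> in M. \<omega> \<in> G k e \<longrightarrow> f \<omega> \<le> exp (c e) * R k \<omega>" if e: "0 < e" for k e
    using q(2) AE_space
  proof eventually_elim
    case (elim \<omega>)
    show ?case
    proof
      assume \<omega>: "\<omega> \<in> G k e"
      let ?SI = "simple_proc_integral B (n k, \<tau> k, \<xi> k)" and ?V = "simple_proc_val (n k, \<tau> k, \<xi> k)"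
      let ?Q = "simple_proc_variation (n k, \<tau> k, \<xi> k) s t \<omega>"
      have H: "(\<lambda>r. H r \<omega>) \<in> borel_measurable (restrict_space borel {0..T})"
        using prog_measurable_path[OF prog T elim(2)] .
      have sub: "{s..t} \<subseteq> {0..T}" using st by auto
      have Hst: "(\<lambda>r. H r \<omega>) \<in> borel_measurable (restrict_space lborel {s..t})"
        using measurable_restrict_mono[OF H sub] by (simp cong: measurable_cong_sets add: sets_restrict_space)
      have Vst: "(\<lambda>r. ?V r \<omega>) \<in> borel_measurable (restrict_space lborel {s..t})"
        unfolding simple_proc_val_def prod.case by (rule measurable_restrict_space1) measurable
      have "ennreal ?Q \<le> (\<integral>\<^sup>+r\<in>{s..t}. ennreal ((?V r \<omega>)\<^sup>2) \<partial>lborel)"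
        by (rule simple_proc_variation_le[OF S st(2)])
      also have "\<dots> \<le> ennreal (1 + d) * (\<integral>\<^sup>+r\<in>{s..t}. ennreal ((H r \<omega>)\<^sup>2) \<partial>lborel)
          + ennreal (1 + 1 / d) * (\<integral>\<^sup>+r\<in>{s..t}. ennreal ((?V r \<omega> - H r \<omega>)\<^sup>2) \<partial>lborel)"
        by (rule nn_integral_power2_le_split[OF d _ Hst Vst]) simp
      also have "\<dots> \<le> ennreal (1 + d) * ennreal (q \<omega>) + ennreal (1 + 1 / d) * ennreal e"
      proof (intro add_mono mult_left_mono)
        have "(\<integral>\<^sup>+r\<in>{s..t}. ennreal ((?V r \<omega> - H r \<omega>)\<^sup>2) \<partial>lborel) \<le> (\<integral>\<^sup>+r\<in>{0..T}. ennreal ((?V r \<omega> - H r \<omega>)\<^sup>2) \<partial>lborel)"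
          using sub by (intro nn_integral_mono mult_left_mono indicator_leI) auto
        also have "\<dots> \<le> ennreal e" by (rule Gv[OF \<omega>])
        finally show "(\<integral>\<^sup>+r\<in>{s..t}. ennreal ((?V r \<omega> - H r \<omega>)\<^sup>2) \<partial>lborel) \<le> ennreal e" .
      qed (use elim in auto)
      also have "\<dots> = ennreal ((1 + d) * q \<omega> + (1 + 1 / d) * e)"
        using d e elim by (simp add: ennreal_mult[symmetric] ennreal_plus[symmetric] del: ennreal_plus)
      finally have Q: "?Q \<le> (1 + d) * q \<omega> + (1 + 1 / d) * e"
        using d e elim by (subst (asm) ennreal_le_iff) auto
      have "\<bar>(I t \<omega> - I s \<omega>) - (?SI t \<omega> - ?SI s \<omega>)\<bar> \<le> 2 * e"
        using Gi[of e \<omega> k t] Gi[of e \<omega> k s] \<omega> e st by auto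
      then have "\<bar>g\<bar> * \<bar>(I t \<omega> - I s \<omega>) - (?SI t \<omega> - ?SI s \<omega>)\<bar> \<le> \<bar>g\<bar> * (2 * e)"
        by (rule mult_left_mono) simp
      then have "g * ((I t \<omega> - I s \<omega>) - (?SI t \<omega> - ?SI s \<omega>)) \<le> \<bar>g\<bar> * (2 * e)"
        by (simp add: abs_mult[symmetric])
      moreover have "g\<^sup>2 / 2 * ?Q \<le> g\<^sup>2 / 2 * ((1 + d) * q \<omega> + (1 + 1 / d) * e)"
        using Q by (rule mult_left_mono) simp
      ultimately have "g * (I t \<omega> - I s \<omega>) - g\<^sup>2 / 2 * ((1 + d) * q \<omega>) \<le>
          c e + (g * (?SI t \<omega> - ?SI s \<omega>) - g\<^sup>2 / 2 * ?Q)"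
        unfolding c_def right_diff_distrib distrib_left[of "g\<^sup>2 / 2"] mult.assoc mult.left_commute[of "\<bar>g\<bar>" 2]
        by linarith
      then show "f \<omega> \<le> exp (c e) * R k \<omega>"
        unfolding f_def R_def by (simp add: exp_add[symmetric])
    qed
  qed
  have bound: "(\<integral>\<^sup>+\<omega>. indicator A \<omega> * ennreal (min C (f \<omega>)) \<partial>M)
      \<le> ennreal (exp (c e)) * emeasure M A + ennreal (C * prob (space M - G k e))" if e: "0 < e" for k e
  proof -
    have [measurable]: "G k e \<in> sets M" by (rule G(1)[OF e])
    have "(\<integral>\<^sup>+\<omega>. indicator A \<omega> * ennreal (min C (f \<omega>)) \<partial>M)
        \<le> (\<integral>\<^sup>+\<omega>. ennreal (exp (c e)) * (indicator A \<omega> * ennreal (R k \<omega>)) + ennreal C * indicator (space M - G k e) \<omega> \<partial>M)"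
    proof (rule nn_integral_mono_AE)
      show "AE \<omega> in M. indicator A \<omega> * ennreal (min C (f \<omega>))
          \<le> ennreal (exp (c e)) * (indicator A \<omega> * ennreal (R k \<omega>)) + ennreal C * indicator (space M - G k e) \<omega>"
        using pt[OF e, of k] AE_space
      proof eventually_elim
        case (elim \<omega>)
        show ?case
        proof (cases "\<omega> \<in> G k e")
          case True
          then have "min C (f \<omega>) \<le> exp (c e) * R k \<omega>" using elim by auto
          then have "ennreal (min C (f \<omega>)) \<le> ennreal (exp (c e)) * ennreal (R k \<omega>)"
            by (subst ennreal_mult[symmetric]) (auto simp: R_def intro!: ennreal_leI)
          then show ?thesis
            using True by (auto split: split_indicator)
        next
          case False
          then show ?thesis
            using elim by (auto split: split_indicator intro!: ennreal_leI add_increasing)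
        qed
      qed
    qed
    also have "\<dots> = ennreal (exp (c e)) * emeasure M A + ennreal C * emeasure M (space M - G k e)"
      by (subst nn_integral_add) (auto simp: nn_integral_cmult R_int nn_integral_cmult_indicator)
    finally show ?thesis
      using C by (simp add: emeasure_eq_measure ennreal_mult)
  qed
  \<comment> \<open>The limits are taken in this order: with \<open>e\<close> fixed,
    \<open>k\<close> tends to infinity and removes the complement of \<open>G k e\<close>; then
    \<open>e\<close> tends to 0 and removes \<open>c e\<close>. Meanwhile \<open>d\<close> stays
    fixed because \<open>c e\<close> contains \<open>1 / d\<close>.\<close>
  have le: "(\<integral>\<^sup>+\<omega>. indicator A \<omega> * ennreal (min C (f \<omega>)) \<partial>M) \<le> ennreal (exp (c e)) * emeasure M A" if e: "0 < e" for e
  proof (rule LIMSEQ_le_const)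
    have "(\<lambda>k. ennreal (exp (c e) * prob A + C * prob (space M - G k e))) \<longlonglongrightarrow> ennreal (exp (c e) * prob A + C * 0)"
      by (intro tendsto_ennrealI tendsto_intros G(2) e)
    then show "(\<lambda>k. ennreal (exp (c e)) * emeasure M A + ennreal (C * prob (space M - G k e))) \<longlonglongrightarrow> ennreal (exp (c e)) * emeasure M A"
      using C by (simp add: emeasure_eq_measure ennreal_mult[symmetric])
  qed (use bound[OF e] in auto)
  show ?thesis
    unfolding f_def[symmetric]
  proof (rule LIMSEQ_le_const)
    have "(\<lambda>k. ennreal (exp (c (inverse (real (Suc k)))) * prob A)) \<longlonglongrightarrow> ennreal (exp (2 * \<bar>g\<bar> * 0 + g\<^sup>2 / 2 * ((1 + 1 / d) * 0)) * prob A)"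
      unfolding c_def by (intro tendsto_ennrealI tendsto_intros LIMSEQ_inverse_real_of_nat)
    then show "(\<lambda>k. ennreal (exp (c (inverse (real (Suc k))))) * emeasure M A) \<longlonglongrightarrow> emeasure M A"
      by (simp add: emeasure_eq_measure ennreal_mult[symmetric])
  qed (use le in auto)
qed

text \<open>The truncation level \<open>k\<close> and the loss \<open>1 / (k + 1)\<close> in front
  of \<open>q\<close> are removed along one sequence by Fatou's lemma: the untruncated exponentials
  converge, so the minimum with \<open>k\<close> is eventually inactive at each point.\<close>

lemma nn_integral_exp_ito_le:
  assumes complete: "complete_measure M" and ito: "has_ito_integral M T B H I"
    and st: "0 \<le> s" "s \<le> t" "t \<le> T" and A: "A \<in> sets (F s)"
    and q: "q \<in> borel_measurable M" "AE \<omega> in M. 0 \<le> q \<omega> \<and> (\<integral>\<^sup>+r\<in>{s..t}. ennreal ((H r \<omega>)\<^sup>2) \<partial>lborel) \<le> ennreal (q \<omega>)"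
  shows "(\<integral>\<^sup>+\<omega>. indicator A \<omega> * ennreal (exp (g * (I t \<omega> - I s \<omega>) - g\<^sup>2 / 2 * q \<omega>)) \<partial>M) \<le> emeasure M A"
proof -
  define h where "h k \<omega> = indicator A \<omega> * ennreal (min (real k) (exp (g * (I t \<omega> - I s \<omega>) - g\<^sup>2 / 2 * ((1 + inverse (real (Suc k))) * q \<omega>))))" for k \<omega>
  have [measurable]: "I t \<in> borel_measurable M" "I s \<in> borel_measurable M"
    using ito st by (auto simp: has_ito_integral_def adapted_to_def intro!: measurable_F_M)
  note [measurable] = q(1)
  have [measurable]: "A \<in> sets M" using A sets_F_subset[of s] st by auto
  have [measurable]: "h k \<in> borel_measurable M" for k unfolding h_def by measurable
  have lim: "(\<lambda>k. h k \<omega>) \<longlonglongrightarrow> indicator A \<omega> * ennreal (exp (g * (I t \<omega> - I s \<omega>) - g\<^sup>2 / 2 * q \<omega>))" for \<omega>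
  proof -
    let ?e = "\<lambda>k. exp (g * (I t \<omega> - I s \<omega>) - g\<^sup>2 / 2 * ((1 + inverse (real (Suc k))) * q \<omega>))"
    have e: "?e \<longlonglongrightarrow> exp (g * (I t \<omega> - I s \<omega>) - g\<^sup>2 / 2 * ((1 + 0) * q \<omega>))"
      by (intro tendsto_intros LIMSEQ_inverse_real_of_nat)
    let ?l = "exp (g * (I t \<omega> - I s \<omega>) - g\<^sup>2 / 2 * ((1 + 0) * q \<omega>))"
    have "\<forall>\<^sub>F k in sequentially. ?e k < ?l + 1"
      by (rule order_tendstoD(2)[OF e]) simp
    moreover have "\<forall>\<^sub>F k in sequentially. ?l + 1 \<le> real k"
      using filterlim_real_sequentially by (auto simp: filterlim_at_top)
    ultimately have "\<forall>\<^sub>F k in sequentially. ?e k = min (real k) (?e k)"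
      by eventually_elim auto
    then have "(\<lambda>k. min (real k) (?e k)) \<longlonglongrightarrow> ?l"
      using e by (rule Lim_transform_eventually[rotated])
    then have "(\<lambda>k. ennreal (min (real k) (?e k))) \<longlonglongrightarrow> ennreal ?l"
      by (rule tendsto_ennrealI)
    then show ?thesis
      unfolding h_def by (auto split: split_indicator)
  qed
  have "(\<integral>\<^sup>+\<omega>. indicator A \<omega> * ennreal (exp (g * (I t \<omega> - I s \<omega>) - g\<^sup>2 / 2 * q \<omega>)) \<partial>M)
      = (\<integral>\<^sup>+\<omega>. liminf (\<lambda>k. h k \<omega>) \<partial>M)"
    by (intro nn_integral_cong) (simp only: lim_imp_Liminf[OF sequentially_bot lim])
  also have "\<dots> \<le> liminf (\<lambda>k. \<integral>\<^sup>+\<omega>. h k \<omega> \<partial>M)"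
    by (rule nn_integral_liminf) simp
  also have "\<dots> \<le> liminf (\<lambda>k. emeasure M A)"
    unfolding h_def
    by (intro Liminf_mono always_eventually allI nn_integral_exp_ito_truncated[OF complete ito st A q]) auto
  also have "liminf (\<lambda>k. emeasure M A) = emeasure M A"
    by (rule Liminf_const) simp
  finally show ?thesis .
qed

end


section \<open>Riemann sums and discrete supermartingales\<close>

text \<open>Mean value theorem and uniform continuity of \<open>f'\<close> on a compact interval.
  The evaluation point \<open>w\<close> is arbitrary in \<open>{u..v}\<close>, so that both left and
  right endpoints can be used.\<close>

lemma uniform_derivative_approx:
  fixes f f' :: "real \<Rightarrow> real"
  assumes deriv: "\<forall>u\<in>{s..t}. (f has_real_derivative f' u) (at u within {s..t})"
    and cont: "continuous_on {s..t} f'" and e: "0 < e"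
  shows "\<exists>\<delta>>0. \<forall>u v w. s \<le> u \<longrightarrow> u \<le> w \<longrightarrow> w \<le> v \<longrightarrow> v \<le> t \<longrightarrow> v - u < \<delta> \<longrightarrow>
    \<bar>f v - f u - f' w * (v - u)\<bar> \<le> e * (v - u)"
proof -
  obtain \<delta> where \<delta>: "0 < \<delta>" "\<And>u v. u \<in> {s..t} \<Longrightarrow> v \<in> {s..t} \<Longrightarrow> \<bar>v - u\<bar> < \<delta> \<Longrightarrow> \<bar>f' v - f' u\<bar> < e"
    using uniformly_continuous_onE[OF compact_uniformly_continuous[OF cont compact_Icc] e]
    unfolding dist_real_def by (metis (no_types))
  show ?thesis
  proof (intro exI[of _ \<delta>] conjI allI impI \<delta>(1))
    fix u v w assume *: "s \<le> u" "u \<le> w" "w \<le> v" "v \<le> t" "v - u < \<delta>"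
    have "\<exists>\<xi>\<in>{u..v}. f v - f u = (\<lambda>h. h * f' \<xi>) (v - u)"
    proof (rule mvt_very_simple)
      show "u \<le> v" using * by simp
      fix x assume "u \<le> x" "x \<le> v"
      then have "(f has_real_derivative f' x) (at x within {u..v})"
        using * by (intro DERIV_subset[OF deriv[rule_format]]) auto
      then show "(f has_derivative (\<lambda>h. h * f' x)) (at x within {u..v})"
        by (simp add: has_field_derivative_def mult.commute[of _ "f' x"])
    qed
    then obtain \<xi> where \<xi>: "\<xi> \<in> {u..v}" "f v - f u = (v - u) * f' \<xi>" by blast
    have "\<bar>f' \<xi> - f' w\<bar> < e"
      by (rule \<delta>(2)) (use \<xi>(1) * in auto)
    then have "(v - u) * \<bar>f' \<xi> - f' w\<bar> \<le> (v - u) * e"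
      using * by (intro mult_left_mono) auto
    moreover have "f v - f u - f' w * (v - u) = (v - u) * (f' \<xi> - f' w)"
      by (simp add: \<xi>(2) algebra_simps)
    ultimately show "\<bar>f v - f u - f' w * (v - u)\<bar> \<le> e * (v - u)"
      using * by (simp add: abs_mult mult.commute)
  qed
qed

text \<open>A discrete product rule for \<open>\<psi> * x\<close> that needs only continuity of
  \<open>x\<close>: all differentiation falls on \<open>\<psi>\<close>, and the \<open>J\<close>
  increments compensate the missing term \<open>x * p\<close>. This takes the place of an Ito
  formula for a time-dependent linear function of the process.\<close>

lemma tendsto_Riemann_Stieltjes_sum:
  fixes x J \<psi> p \<Psi> :: "real \<Rightarrow> real" and s t a :: real
  assumes st: "s \<le> t" and x: "continuous_on {s..t} x" and p: "continuous_on {s..t} p"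
    and J: "\<forall>u\<in>{s..t}. (J has_real_derivative x u) (at u within {s..t})"
    and \<psi>: "\<forall>u\<in>{s..t}. (\<psi> has_real_derivative p u) (at u within {s..t})"
    and \<Psi>: "\<forall>u\<in>{s..t}. (\<Psi> has_real_derivative \<psi> u) (at u within {s..t})"
  defines "r \<equiv> \<lambda>N j. s + (t - s) * real j / real (Suc N)"
  shows "(\<lambda>N. \<Sum>j<Suc N. \<psi> (r N j) * (x (r N (Suc j)) - x (r N j)) - a * (\<psi> (r N j) * (r N (Suc j) - r N j))
      + p (r N j) * (J (r N (Suc j)) - J (r N j)))
    \<longlonglongrightarrow> \<psi> t * x t - \<psi> s * x s - a * (\<Psi> t - \<Psi> s)"
proof -
  obtain C1 where C1: "0 < C1" "\<And>u. u \<in> {s..t} \<Longrightarrow> \<bar>x u\<bar> \<le> C1"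
    using compact_imp_bounded[OF compact_continuous_image[OF x compact_Icc]] unfolding bounded_pos by auto
  obtain C2 where C2: "0 < C2" "\<And>u. u \<in> {s..t} \<Longrightarrow> \<bar>p u\<bar> \<le> C2"
    using compact_imp_bounded[OF compact_continuous_image[OF p compact_Icc]] unfolding bounded_pos by auto
  define C where "C = C1 + C2 + \<bar>a\<bar>"
  have C: "0 < C" using C1 C2 by (simp add: C_def)
  have \<psi>_cont: "continuous_on {s..t} \<psi>"
    by (rule DERIV_continuous_on[OF \<psi>[rule_format]])
  let ?term = "\<lambda>N j. \<psi> (r N j) * (x (r N (Suc j)) - x (r N j)) - a * (\<psi> (r N j) * (r N (Suc j) - r N j))
      + p (r N j) * (J (r N (Suc j)) - J (r N j))"
  let ?lim = "\<psi> t * x t - \<psi> s * x s - a * (\<Psi> t - \<Psi> s)"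
  have r0: "r N 0 = s" and rN: "r N (Suc N) = t" for N by (auto simp: r_def)
  have step: "r N (Suc j) - r N j = (t - s) / real (Suc N)" for N j
    by (simp add: r_def diff_divide_distrib[symmetric] right_diff_distrib[symmetric])
  have r_in: "s \<le> r N j" "r N j \<le> t" if "j \<le> Suc N" for N j
    unfolding r_def using grid_bounds[OF st that] by auto
  show ?thesis
  proof (rule LIMSEQ_I)
    fix e :: real assume e: "0 < e"
    \<comment> \<open>The local errors add up to \<open>C * e' * (t - s)\<close>, which is at most
      \<open>e / 2\<close>; the summand 1 keeps the denominator positive when
      \<open>s = t\<close>.\<close>
    define e' where "e' = e / (2 * C * (t - s + 1))"
    have e': "0 < e'" using e C st by (simp add: e'_def)
    obtain d1 where d1: "0 < d1" "\<forall>u v w. s \<le> u \<longrightarrow> u \<le> w \<longrightarrow> w \<le> v \<longrightarrow> v \<le> t \<longrightarrow> v - u < d1 \<longrightarrow>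
        \<bar>J v - J u - x w * (v - u)\<bar> \<le> e' * (v - u)"
      using uniform_derivative_approx[OF J x e'] by (elim exE conjE)
    obtain d2 where d2: "0 < d2" "\<forall>u v w. s \<le> u \<longrightarrow> u \<le> w \<longrightarrow> w \<le> v \<longrightarrow> v \<le> t \<longrightarrow> v - u < d2 \<longrightarrow>
        \<bar>\<psi> v - \<psi> u - p w * (v - u)\<bar> \<le> e' * (v - u)"
      using uniform_derivative_approx[OF \<psi> p e'] by (elim exE conjE)
    obtain d3 where d3: "0 < d3" "\<forall>u v w. s \<le> u \<longrightarrow> u \<le> w \<longrightarrow> w \<le> v \<longrightarrow> v \<le> t \<longrightarrow> v - u < d3 \<longrightarrow>
        \<bar>\<Psi> v - \<Psi> u - \<psi> w * (v - u)\<bar> \<le> e' * (v - u)"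
      using uniform_derivative_approx[OF \<Psi> \<psi>_cont e'] by (elim exE conjE)
    define d where "d = Min {d1, d2, d3}"
    have d: "0 < d" "d \<le> d1" "d \<le> d2" "d \<le> d3" using d1 d2 d3 by (auto simp: d_def)
    obtain N0 :: nat where N0: "(t - s) / d < real N0" using reals_Archimedean2 by blast
    show "\<exists>N0. \<forall>N\<ge>N0. norm ((\<Sum>j<Suc N. ?term N j) - ?lim) < e"
    proof (intro exI allI impI)
      fix N assume N: "N0 \<le> N"
      have small: "(t - s) / real (Suc N) < d"
      proof -
        have "(t - s) / d < real (Suc N)" using N0 N by simp
        then show ?thesis using d(1) by (simp add: pos_divide_less_eq mult.commute del: of_nat_Suc)
      qed
      have err: "\<bar>?term N j - ((\<psi> (r N (Suc j)) * x (r N (Suc j)) - a * \<Psi> (r N (Suc j))) - (\<psi> (r N j) * x (r N j) - a * \<Psi> (r N j)))\<bar>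
          \<le> C * e' * ((t - s) / real (Suc N))" if "j < Suc N" for j
      proof -
        define u v where "u = r N j" and "v = r N (Suc j)"
        have vu: "v - u = (t - s) / real (Suc N)" by (simp add: u_def v_def step)
        have "0 \<le> v - u" using st by (simp add: vu)
        then have uv: "s \<le> u" "u \<le> v" "v \<le> t"
          using r_in(1)[of j N] r_in(2)[of "Suc j" N] that unfolding u_def v_def by simp_all
        have small': "v - u < d1" "v - u < d2" "v - u < d3" using small d unfolding vu by auto
        \<comment> \<open>Here the derivative is taken at the right endpoint, because summation by
          parts leaves \<open>x v\<close> in front of the increment of
          \<open>\<psi>\<close>.\<close>
        have e1: "\<bar>J v - J u - x v * (v - u)\<bar> \<le> e' * (v - u)"
          by (rule d1(2)[rule_format]) (use uv small' in auto)
        have e2: "\<bar>\<psi> v - \<psi> u - p u * (v - u)\<bar> \<le> e' * (v - u)"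
          by (rule d2(2)[rule_format]) (use uv small' in auto)
        have e3: "\<bar>\<Psi> v - \<Psi> u - \<psi> u * (v - u)\<bar> \<le> e' * (v - u)"
          by (rule d3(2)[rule_format]) (use uv small' in auto)
        have "\<psi> u * (x v - x u) - a * (\<psi> u * (v - u)) + p u * (J v - J u) - ((\<psi> v * x v - a * \<Psi> v) - (\<psi> u * x u - a * \<Psi> u))
          = p u * (J v - J u - x v * (v - u)) - x v * (\<psi> v - \<psi> u - p u * (v - u)) + a * (\<Psi> v - \<Psi> u - \<psi> u * (v - u))"
          (is "?l = ?r1 - ?r2 + ?r3")
          by (simp add: algebra_simps)
        also have "\<bar>?r1 - ?r2 + ?r3\<bar> \<le> \<bar>?r1\<bar> + \<bar>?r2\<bar> + \<bar>?r3\<bar>" by linarith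
        also have "\<dots> \<le> C2 * (e' * (v - u)) + C1 * (e' * (v - u)) + \<bar>a\<bar> * (e' * (v - u))"
          unfolding abs_mult using e1 e2 e3 C1(1) C2(1) C1(2)[of v] C2(2)[of u] uv
          by (intro add_mono mult_mono) auto
        also have "\<dots> = C * e' * (v - u)" by (simp add: C_def algebra_simps)
        finally show ?thesis unfolding vu[symmetric] by (simp add: u_def v_def)
      qed
      have "?lim = (\<Sum>j<Suc N. (\<psi> (r N (Suc j)) * x (r N (Suc j)) - a * \<Psi> (r N (Suc j))) - (\<psi> (r N j) * x (r N j) - a * \<Psi> (r N j)))"
        unfolding sum_lessThan_telescope[of "\<lambda>j. \<psi> (r N j) * x (r N j) - a * \<Psi> (r N j)"] r0 rN
        by (simp add: algebra_simps)
      then have "\<bar>(\<Sum>j<Suc N. ?term N j) - ?lim\<bar> = \<bar>\<Sum>j<Suc N. ?term N j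
          - ((\<psi> (r N (Suc j)) * x (r N (Suc j)) - a * \<Psi> (r N (Suc j))) - (\<psi> (r N j) * x (r N j) - a * \<Psi> (r N j)))\<bar>"
        by (simp only: sum_subtractf)
      also have "\<dots> \<le> (\<Sum>j<Suc N. C * e' * ((t - s) / real (Suc N)))"
        by (rule order_trans[OF sum_abs sum_mono]) (use err in auto)
      also have "\<dots> = C * e' * (t - s)"
        unfolding sum_constant card_lessThan by (simp del: of_nat_Suc)
      also have "\<dots> = e / 2 * ((t - s) / (t - s + 1))"
        using C by (simp add: e'_def)
      also have "\<dots> \<le> e / 2 * 1" using e st by (intro mult_left_mono) auto
      also have "\<dots> < e" using e by simp
      finally show "norm ((\<Sum>j<Suc N. ?term N j) - ?lim) < e" by (simp only: real_norm_def)
    qed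
  qed
qed

section \<open>Products of supermartingale factors and their maximal inequality\<close>

lemma nn_integral_prod_le:
  fixes \<rho> :: "nat \<Rightarrow> 'a \<Rightarrow> ennreal"
  assumes sub: "\<And>k. k \<le> N \<Longrightarrow> subalgebra M (\<F> k)"
    and mono: "\<And>k. k < N \<Longrightarrow> sets (\<F> k) \<subseteq> sets (\<F> (Suc k))"
    and \<rho>: "\<And>k. k < N \<Longrightarrow> \<rho> k \<in> borel_measurable (\<F> (Suc k))"
    and le: "\<And>k A. k < N \<Longrightarrow> A \<in> sets (\<F> k) \<Longrightarrow> (\<integral>\<^sup>+\<omega>. indicator A \<omega> * \<rho> k \<omega> \<partial>M) \<le> emeasure M A"
    and f: "f \<in> borel_measurable (\<F> 0)"
  shows "(\<integral>\<^sup>+\<omega>. f \<omega> * (\<Prod>j<N. \<rho> j \<omega>) \<partial>M) \<le> (\<integral>\<^sup>+\<omega>. f \<omega> \<partial>M)"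
proof -
  have mon: "borel_measurable (\<F> i) \<subseteq> (borel_measurable (\<F> k) :: ('a \<Rightarrow> ennreal) set)" if "i \<le> k" "k \<le> N" for i k
  proof -
    have "sets (\<F> i) \<subseteq> sets (\<F> k)"
      using step_mono_upto[where f = "\<lambda>k. sets (\<F> k)", OF mono that] .
    moreover have "space (\<F> i) = space (\<F> k)"
      using sub[of i] sub[of k] that by (simp add: subalgebra_def)
    ultimately show ?thesis by (auto simp: measurable_def)
  qed
  \<comment> \<open>Measurability is part of the induction because the partial product serves as the
    test function against the next factor.\<close>
  have "(\<lambda>\<omega>. f \<omega> * (\<Prod>j<k. \<rho> j \<omega>)) \<in> borel_measurable (\<F> k) \<and>
      (\<integral>\<^sup>+\<omega>. f \<omega> * (\<Prod>j<k. \<rho> j \<omega>) \<partial>M) \<le> (\<integral>\<^sup>+\<omega>. f \<omega> \<partial>M)" if "k \<le> N" for k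
    using that
  proof (induction k)
    case 0
    then show ?case using f by simp
  next
    case (Suc k)
    then have IH: "(\<lambda>\<omega>. f \<omega> * (\<Prod>j<k. \<rho> j \<omega>)) \<in> borel_measurable (\<F> k)"
      "(\<integral>\<^sup>+\<omega>. f \<omega> * (\<Prod>j<k. \<rho> j \<omega>) \<partial>M) \<le> (\<integral>\<^sup>+\<omega>. f \<omega> \<partial>M)" by auto
    have eq: "f \<omega> * (\<Prod>j<Suc k. \<rho> j \<omega>) = f \<omega> * (\<Prod>j<k. \<rho> j \<omega>) * \<rho> k \<omega>" for \<omega>
      by (simp add: mult.assoc)
    have \<rho>k: "\<rho> k \<in> borel_measurable (\<F> (Suc k))" using \<rho> Suc.prems by simp
    have "\<rho> k \<in> borel_measurable M"
      using sub[of "Suc k"] \<rho>k Suc.prems by (auto intro: measurable_from_subalg)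
    then have "(\<integral>\<^sup>+\<omega>. f \<omega> * (\<Prod>j<k. \<rho> j \<omega>) * \<rho> k \<omega> \<partial>M) \<le> (\<integral>\<^sup>+\<omega>. f \<omega> * (\<Prod>j<k. \<rho> j \<omega>) \<partial>M)"
      using sub[of k] Suc.prems IH(1) le[of k]
      by (intro nn_integral_mult_le_of_indicator_le[of M "\<F> k"]) auto
    moreover have "(\<lambda>\<omega>. f \<omega> * (\<Prod>j<k. \<rho> j \<omega>)) \<in> borel_measurable (\<F> (Suc k))"
      using IH(1) mon[of k "Suc k"] Suc.prems by auto
    ultimately show ?case
      unfolding eq using IH(2) \<rho>k by (auto intro: order_trans borel_measurable_times)
  qed
  then show ?thesis by blast
qed

lemma (in prob_space) prob_prod_ge_le:
  fixes \<rho> :: "nat \<Rightarrow> 'a \<Rightarrow> ennreal"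
  assumes sub: "\<And>k. k \<le> N \<Longrightarrow> subalgebra M (\<F> k)"
    and mono: "\<And>k. k < N \<Longrightarrow> sets (\<F> k) \<subseteq> sets (\<F> (Suc k))"
    and \<rho>: "\<And>k. k < N \<Longrightarrow> \<rho> k \<in> borel_measurable (\<F> (Suc k))"
    and le: "\<And>k A. k < N \<Longrightarrow> A \<in> sets (\<F> k) \<Longrightarrow> (\<integral>\<^sup>+\<omega>. indicator A \<omega> * \<rho> k \<omega> \<partial>M) \<le> emeasure M A"
  shows "c * emeasure M {\<omega> \<in> space M. \<exists>i\<le>N. c \<le> (\<Prod>j<i. \<rho> j \<omega>)} \<le> 1"
proof -
  have sets_mono: "sets (\<F> i) \<subseteq> sets (\<F> k)" if "i \<le> k" "k \<le> N" for i k
    using step_mono_upto[where f = "\<lambda>k. sets (\<F> k)", OF mono that] .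
  have space: "space (\<F> k) = space M" if "k \<le> N" for k
    using sub[OF that] by (simp add: subalgebra_def)
  have mon: "\<rho> j \<in> borel_measurable (\<F> k)" if "j < k" "k \<le> N" for j k
    using \<rho>[of j] sets_mono[of "Suc j" k] space[of k] space[of "Suc j"] that by (auto simp: measurable_def)
  define S where "S k = {\<omega> \<in> space M. \<exists>i\<le>k. c \<le> (\<Prod>j<i. \<rho> j \<omega>)}" for k
  \<comment> \<open>\<open>S k\<close> depends only on the factors before index \<open>k\<close>, so
    the decision to freeze factor \<open>k\<close> is known at stage \<open>k\<close>.\<close>
  define \<rho>' where "\<rho>' k \<omega> = (if \<omega> \<in> S k then 1 else \<rho> k \<omega>)" for k \<omega>
  have S [measurable]: "S k \<in> sets (\<F> k)" if "k \<le> N" for k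
  proof -
    have "(\<lambda>\<omega>. \<Prod>j<i. \<rho> j \<omega>) \<in> borel_measurable (\<F> k)" if "i \<le> k" for i
      using that \<open>k \<le> N\<close> by (intro borel_measurable_prod_ennreal mon) auto
    then have [measurable]: "{\<omega> \<in> space (\<F> k). c \<le> (\<Prod>j<i. \<rho> j \<omega>)} \<in> sets (\<F> k)" if "i \<le> k" for i
      using that by measurable
    have "S k = (\<Union>i\<in>{..k}. {\<omega> \<in> space (\<F> k). c \<le> (\<Prod>j<i. \<rho> j \<omega>)})"
      using space[OF that] by (auto simp: S_def)
    also have "\<dots> \<in> sets (\<F> k)" by auto
    finally show ?thesis .
  qed
  have \<rho>': "\<rho>' k \<in> borel_measurable (\<F> (Suc k))" if "k < N" for k
  proof -
    have [measurable]: "S k \<in> sets (\<F> (Suc k))" "\<rho> k \<in> borel_measurable (\<F> (Suc k))"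
      using S[of k] sets_mono[of k "Suc k"] \<rho>[of k] that by auto
    show ?thesis unfolding \<rho>'_def by measurable
  qed
  have le': "(\<integral>\<^sup>+\<omega>. indicator A \<omega> * \<rho>' k \<omega> \<partial>M) \<le> emeasure M A" if "k < N" "A \<in> sets (\<F> k)" for k A
  proof -
    have [measurable]: "A \<in> sets M" "S k \<in> sets M" "\<rho> k \<in> borel_measurable M"
      using that S[of k] sub[of k] sub[of "Suc k"] \<rho>[of k]
      by (auto simp: subalgebra_def intro: measurable_from_subalg)
    have "(\<integral>\<^sup>+\<omega>. indicator A \<omega> * \<rho>' k \<omega> \<partial>M) = (\<integral>\<^sup>+\<omega>. indicator (A \<inter> S k) \<omega> + indicator (A - S k) \<omega> * \<rho> k \<omega> \<partial>M)"
      by (intro nn_integral_cong) (auto simp: \<rho>'_def split: split_indicator)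
    also have "\<dots> = emeasure M (A \<inter> S k) + (\<integral>\<^sup>+\<omega>. indicator (A - S k) \<omega> * \<rho> k \<omega> \<partial>M)"
      by (subst nn_integral_add) auto
    also have "\<dots> \<le> emeasure M (A \<inter> S k) + emeasure M (A - S k)"
      using that S[of k] le[of k "A - S k"] by (intro add_left_mono) auto
    also have "\<dots> = emeasure M A"
      by (subst plus_emeasure) (auto intro: arg_cong[where f = "emeasure M"])
    finally show ?thesis .
  qed
  have ge: "c \<le> (\<Prod>j<N. \<rho>' j \<omega>)" if \<omega>: "\<omega> \<in> S N" for \<omega>
  proof -
    \<comment> \<open>The first passage index: factors before it are unmodified, factors from it on
      equal 1, and the product up to \<open>N\<close> is therefore the value at first
      passage.\<close>
    define i where "i = (LEAST i. c \<le> (\<Prod>j<i. \<rho> j \<omega>))"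
    obtain i' where i': "i' \<le> N" "c \<le> (\<Prod>j<i'. \<rho> j \<omega>)" using \<omega> by (auto simp: S_def)
    have i: "c \<le> (\<Prod>j<i. \<rho> j \<omega>)" unfolding i_def by (rule LeastI) (rule i')
    have "i \<le> i'" unfolding i_def by (rule Least_le) (rule i')
    then have iN: "i \<le> N" using i' by simp
    have not: "\<not> c \<le> (\<Prod>j<m. \<rho> j \<omega>)" if "m < i" for m
      using not_less_Least[of m] that unfolding i_def by blast
    have "(\<Prod>j<N. \<rho>' j \<omega>) = (\<Prod>j\<in>{..<i}. \<rho>' j \<omega>)"
    proof (rule prod.mono_neutral_right)
      show "\<forall>j\<in>{..<N} - {..<i}. \<rho>' j \<omega> = 1"
        using i \<omega> by (auto simp: \<rho>'_def S_def)
    qed (use iN in auto)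
    also have "\<dots> = (\<Prod>j<i. \<rho> j \<omega>)"
      using not by (intro prod.cong) (auto simp: \<rho>'_def S_def)
    finally show ?thesis using i by simp
  qed
  have SN: "S N \<in> sets M" using S[of N] sub[of N] by (auto simp: subalgebra_def)
  have "c * emeasure M (S N) = (\<integral>\<^sup>+\<omega>. c * indicator (S N) \<omega> \<partial>M)"
    using SN by (simp add: nn_integral_cmult_indicator)
  also have "\<dots> \<le> (\<integral>\<^sup>+\<omega>. 1 * (\<Prod>j<N. \<rho>' j \<omega>) \<partial>M)"
    using ge by (intro nn_integral_mono) (auto split: split_indicator)
  also have "\<dots> \<le> (\<integral>\<^sup>+\<omega>. 1 \<partial>M)"
    by (rule nn_integral_prod_le[where \<F> = \<F>]) (use sub mono \<rho>' le' in auto)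
  finally show ?thesis by (simp add: S_def emeasure_space_1)
qed


section \<open>The exponential supermartingale\<close>

lemma prod_ennreal_exp: "finite A \<Longrightarrow> (\<Prod>j\<in>A. ennreal (exp (f j))) = ennreal (exp (\<Sum>j\<in>A. f j))"
  by (simp add: exp_sum prod_ennreal)

locale cir_solution = brownian M T B
  for M :: "'a measure" and T :: real and B :: "real \<Rightarrow> 'a \<Rightarrow> real" +
  fixes x0 a b \<sigma> :: real and X I :: "real \<Rightarrow> 'a \<Rightarrow> real"
  assumes complete: "complete_measure M"
    and T_pos: "0 < T" and x0_pos: "0 < x0" and a_pos: "0 < a" and b_pos: "0 < b" and \<sigma>_pos: "0 < \<sigma>"
    and X_adapted: "adapted_to F T X"
    and X_continuous: "AE \<omega> in M. continuous_on {0..T} (\<lambda>t. X t \<omega>)"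
    and X_positive: "AE \<omega> in M. \<forall>t\<in>{0..T}. X t \<omega> > 0"
    and ito: "has_ito_integral M T B (\<lambda>s \<omega>. \<sigma> * sqrt (X s \<omega>)) I"
    and X_eq: "AE \<omega> in M. \<forall>t\<in>{0..T}. X t \<omega> = x0 + (LBINT s:{0..t}. a - b * X s \<omega>) + I t \<omega>"
begin

lemma X_measurable_F: "0 \<le> s \<Longrightarrow> s \<le> t \<Longrightarrow> t \<le> T \<Longrightarrow> X s \<in> borel_measurable (F t)"
  by (rule measurable_F_mono[of _ s]) (use X_adapted in \<open>auto simp: adapted_to_def\<close>)

lemma I_measurable_F: "0 \<le> s \<Longrightarrow> s \<le> t \<Longrightarrow> t \<le> T \<Longrightarrow> I s \<in> borel_measurable (F t)"
  by (rule measurable_F_mono[of _ s]) (use ito in \<open>auto simp: has_ito_integral_def adapted_to_def\<close>)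

lemma X_measurable: "0 \<le> t \<Longrightarrow> t \<le> T \<Longrightarrow> X t \<in> borel_measurable M"
  by (rule measurable_F_M[OF X_measurable_F[of t t]]) auto

definition J :: "real \<Rightarrow> 'a \<Rightarrow> real" where
  "J t \<omega> = integral {0..t} (\<lambda>s. X s \<omega>)"

text \<open>The equation expresses the quadratic variation through adapted processes, so that its
  adaptedness needs no argument about integrals of \<open>X\<close>.\<close>

definition qvar :: "real \<Rightarrow> real \<Rightarrow> 'a \<Rightarrow> real" where
  "qvar s t \<omega> = \<sigma>\<^sup>2 / b * (I t \<omega> - I s \<omega> - (X t \<omega> - X s \<omega>) + a * (t - s))"

text \<open>The almost sure set on which all later arguments are deterministic calculus; the
  equation is solved for \<open>I\<close> so that the stochastic integral can be eliminated
  pathwise.\<close>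

definition regular :: "'a \<Rightarrow> bool" where
  "regular \<omega> \<longleftrightarrow> continuous_on {0..T} (\<lambda>t. X t \<omega>) \<and> (\<forall>t\<in>{0..T}. 0 < X t \<omega>) \<and> X 0 \<omega> = x0 \<and>
     (\<forall>t\<in>{0..T}. I t \<omega> = X t \<omega> - x0 - a * t + b * J t \<omega>)"

lemma AE_regular: "AE \<omega> in M. regular \<omega>"
  using X_continuous X_positive X_eq AE_ito_integral_0[OF complete ito less_imp_le[OF T_pos]]
proof eventually_elim
  case (elim \<omega>)
  have lint: "(LBINT s:{0..t}. a - b * X s \<omega>) = a * t - b * J t \<omega>" if t: "t \<in> {0..T}" for t
  proof -
    have c: "continuous_on {0..t} (\<lambda>s. X s \<omega>)"
      using elim(1) t by (auto intro: continuous_on_subset)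
    have "set_integrable lborel {0..t} (\<lambda>s. a - b * X s \<omega>)"
      by (rule borel_integrable_atLeastAtMost') (intro continuous_intros c)
    then have "(LBINT s:{0..t}. a - b * X s \<omega>) = integral {0..t} (\<lambda>s. a - b * X s \<omega>)"
      by (rule set_borel_integral_eq_integral(2))
    also have "\<dots> = integral {0..t} (\<lambda>s. a) - integral {0..t} (\<lambda>s. b * X s \<omega>)"
      by (rule integral_diff) (auto intro!: integrable_continuous_real continuous_intros c)
    finally show ?thesis using t by (simp add: J_def)
  qed
  have "X 0 \<omega> = x0"
    using elim(3,4) lint[of 0] T_pos by (simp add: J_def)
  moreover have "I t \<omega> = X t \<omega> - x0 - a * t + b * J t \<omega>" if "t \<in> {0..T}" for t
    using elim(3) lint[OF that] that by (simp add: algebra_simps)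
  ultimately show ?case using elim by (auto simp: regular_def)
qed

lemma regular_I: "regular \<omega> \<Longrightarrow> 0 \<le> t \<Longrightarrow> t \<le> T \<Longrightarrow> I t \<omega> = X t \<omega> - x0 - a * t + b * J t \<omega>"
  by (auto simp: regular_def)

lemma J_has_derivative:
  assumes "regular \<omega>" "0 \<le> s" "t \<le> T" "u \<in> {s..t}"
  shows "((\<lambda>t. J t \<omega>) has_real_derivative X u \<omega>) (at u within {s..t})"
proof -
  have "((\<lambda>t. integral {0..t} (\<lambda>s. X s \<omega>)) has_real_derivative X u \<omega>) (at u within {0..T})"
    by (rule integral_has_real_derivative) (use assms in \<open>auto simp: regular_def\<close>)
  then show ?thesis
    unfolding J_def using assms by (auto intro: DERIV_subset)
qed

lemma qvar_eq:
  assumes "regular \<omega>" "0 \<le> s" "s \<le> t" "t \<le> T"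
  shows "qvar s t \<omega> = \<sigma>\<^sup>2 * (J t \<omega> - J s \<omega>)"
proof -
  have "I t \<omega> - I s \<omega> - (X t \<omega> - X s \<omega>) + a * (t - s) = b * (J t \<omega> - J s \<omega>)"
    using regular_I[OF assms(1), of s] regular_I[OF assms(1), of t] assms by (simp add: right_diff_distrib)
  then show ?thesis using b_pos by (simp add: qvar_def)
qed

lemma qvar_nn_integral:
  assumes reg: "regular \<omega>" and st: "0 \<le> s" "s \<le> t" "t \<le> T"
  shows "0 \<le> qvar s t \<omega> \<and> (\<integral>\<^sup>+r\<in>{s..t}. ennreal ((\<sigma> * sqrt (X r \<omega>))\<^sup>2) \<partial>lborel) \<le> ennreal (qvar s t \<omega>)"
proof -
  have pos: "0 < X r \<omega>" if "r \<in> {s..t}" for r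
    using reg st that by (auto simp: regular_def)
  have c: "continuous_on {s..t} (\<lambda>r. X r \<omega>)"
    using reg st by (auto simp: regular_def intro: continuous_on_subset)
  have c': "continuous_on {s..t} (\<lambda>r. \<sigma>\<^sup>2 * X r \<omega>)" by (intro continuous_intros c)
  have "continuous_on {0..t} (\<lambda>r. X r \<omega>)"
    using reg st by (auto simp: regular_def intro: continuous_on_subset)
  then have "(\<lambda>r. X r \<omega>) integrable_on {0..t}" by (rule integrable_continuous_real)
  from Henstock_Kurzweil_Integration.integral_combine[OF st(1,2) this]
  have hk: "integral {s..t} (\<lambda>r. \<sigma>\<^sup>2 * X r \<omega>) = qvar s t \<omega>"
    by (simp add: J_def qvar_eq[OF reg st])
  have int: "set_integrable lborel {s..t} (\<lambda>r. \<sigma>\<^sup>2 * X r \<omega>)"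
    by (rule borel_integrable_atLeastAtMost'[OF c'])
  have "(\<integral>\<^sup>+r\<in>{s..t}. ennreal ((\<sigma> * sqrt (X r \<omega>))\<^sup>2) \<partial>lborel)
      = (\<integral>\<^sup>+r. ennreal (indicator {s..t} r * (\<sigma>\<^sup>2 * X r \<omega>)) \<partial>lborel)"
    using pos by (intro nn_integral_cong) (auto simp: power_mult_distrib less_imp_le split: split_indicator)
  also have "\<dots> = ennreal (LBINT r:{s..t}. \<sigma>\<^sup>2 * X r \<omega>)"
    using int pos unfolding set_integrable_def set_lebesgue_integral_def
    by (subst nn_integral_eq_integral) (auto simp: less_imp_le split: split_indicator)
  also have "(LBINT r:{s..t}. \<sigma>\<^sup>2 * X r \<omega>) = integral {s..t} (\<lambda>r. \<sigma>\<^sup>2 * X r \<omega>)"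
    by (rule set_borel_integral_eq_integral(2)[OF int])
  also note hk
  finally have eq: "(\<integral>\<^sup>+r\<in>{s..t}. ennreal ((\<sigma> * sqrt (X r \<omega>))\<^sup>2) \<partial>lborel) = ennreal (qvar s t \<omega>)" .
  have "0 \<le> integral {s..t} (\<lambda>r. \<sigma>\<^sup>2 * X r \<omega>)"
    using pos by (intro integral_nonneg integrable_continuous_real c') (auto simp: less_imp_le)
  then show ?thesis using eq hk by simp
qed

lemma qvar_measurable_F:
  assumes "0 \<le> s" "s \<le> t" "t \<le> T"
  shows "qvar s t \<in> borel_measurable (F t)"
proof -
  have [measurable]: "X t \<in> borel_measurable (F t)" "I t \<in> borel_measurable (F t)"
    "X s \<in> borel_measurable (F t)" "I s \<in> borel_measurable (F t)"
    using assms by (auto intro: X_measurable_F I_measurable_F)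
  show ?thesis unfolding qvar_def by measurable
qed

lemma nn_integral_exp_step:
  assumes st: "0 \<le> s" "s \<le> t" "t \<le> T" and A: "A \<in> sets (F s)"
  shows "(\<integral>\<^sup>+\<omega>. indicator A \<omega> * ennreal (exp (g * (I t \<omega> - I s \<omega>) - g\<^sup>2 / 2 * qvar s t \<omega>)) \<partial>M) \<le> emeasure M A"
proof (rule nn_integral_exp_ito_le[OF complete ito st A])
  show "qvar s t \<in> borel_measurable M"
    by (rule measurable_F_M[OF qvar_measurable_F[OF st] st(3)])
  show "AE \<omega> in M. 0 \<le> qvar s t \<omega> \<and> (\<integral>\<^sup>+r\<in>{s..t}. ennreal ((\<sigma> * sqrt (X r \<omega>))\<^sup>2) \<partial>lborel) \<le> ennreal (qvar s t \<omega>)"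
    using AE_regular by eventually_elim (rule qvar_nn_integral[OF _ st])
qed

text \<open>If \<open>\<psi>' = b \<psi> - \<sigma>\<^sup>2 \<psi>\<^sup>2 / 2\<close> and \<open>\<Psi>' = \<psi>\<close>, then \<open>exp (\<psi> X - a \<Psi>)\<close> is the stochastic exponential of the
  integral of \<open>\<psi>\<close> against the martingale part of \<open>X\<close>. It is approximated by products over fine grids
  with \<open>\<psi>\<close> frozen on each interval.\<close>

definition riccati :: "real \<Rightarrow> (real \<Rightarrow> real) \<Rightarrow> (real \<Rightarrow> real) \<Rightarrow> bool" where
  "riccati h \<psi> \<Psi> \<longleftrightarrow> 0 \<le> h \<and> h \<le> T \<and>
    (\<forall>u\<in>{0..h}. (\<psi> has_real_derivative b * \<psi> u - \<sigma>\<^sup>2 / 2 * (\<psi> u)\<^sup>2) (at u within {0..h})) \<and>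
    (\<forall>u\<in>{0..h}. (\<Psi> has_real_derivative \<psi> u) (at u within {0..h}))"

lemma exp_supermartingale:
  assumes ric: "riccati h \<psi> \<Psi>" and st: "0 \<le> s" "s \<le> t" "t \<le> h" and A: "A \<in> sets (F s)"
  shows "(\<integral>\<^sup>+\<omega>. indicator A \<omega> * ennreal (exp (\<psi> t * X t \<omega> - \<psi> s * X s \<omega> - a * (\<Psi> t - \<Psi> s))) \<partial>M) \<le> emeasure M A"
proof -
  have h: "0 \<le> h" "h \<le> T" using ric by (auto simp: riccati_def)
  have sub: "{s..t} \<subseteq> {0..h}" using st by auto
  define p where "p u = b * \<psi> u - \<sigma>\<^sup>2 / 2 * (\<psi> u)\<^sup>2" for u
  have \<psi>: "\<forall>u\<in>{s..t}. (\<psi> has_real_derivative p u) (at u within {s..t})"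
    using ric sub by (auto simp: riccati_def p_def intro: DERIV_subset[OF _ sub])
  have \<Psi>: "\<forall>u\<in>{s..t}. (\<Psi> has_real_derivative \<psi> u) (at u within {s..t})"
    using ric sub by (auto simp: riccati_def intro: DERIV_subset[OF _ sub])
  have \<psi>_cont: "continuous_on {s..t} \<psi>" by (rule DERIV_continuous_on[OF \<psi>[rule_format]])
  have p_cont: "continuous_on {s..t} p" unfolding p_def by (intro continuous_intros \<psi>_cont)
  define r where "r N j = s + (t - s) * real j / real (Suc N)" for N j
  have r_in: "s \<le> r N j" "r N j \<le> t" if "j \<le> Suc N" for N j
    unfolding r_def using grid_bounds[OF st(2) that] by auto
  have r_in': "0 \<le> r N j" "r N j \<le> T" if "j \<le> Suc N" for N j
    using r_in[OF that] st h by auto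
  have r_step: "r N j \<le> r N (Suc j)" for N j
    unfolding r_def using st by (intro add_left_mono divide_right_mono mult_left_mono) auto
  have r0: "r N 0 = s" for N by (simp add: r_def)
  define E where "E N j \<omega> = \<psi> (r N j) * (I (r N (Suc j)) \<omega> - I (r N j) \<omega>)
      - (\<psi> (r N j))\<^sup>2 / 2 * qvar (r N j) (r N (Suc j)) \<omega>" for N j \<omega>
  define \<rho> where "\<rho> N j \<omega> = ennreal (exp (E N j \<omega>))" for N j \<omega>
  have \<rho>_meas: "\<rho> N k \<in> borel_measurable (F (r N (Suc k)))" if "k < Suc N" for N k
  proof -
    have [measurable]: "I (r N (Suc k)) \<in> borel_measurable (F (r N (Suc k)))"
      "I (r N k) \<in> borel_measurable (F (r N (Suc k)))"
      "qvar (r N k) (r N (Suc k)) \<in> borel_measurable (F (r N (Suc k)))"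
      using that r_in'[of k N] r_in'[of "Suc k" N] r_step[of N k]
      by (auto intro!: I_measurable_F qvar_measurable_F)
    show ?thesis unfolding \<rho>_def E_def by measurable
  qed
  have AM [measurable]: "A \<in> sets M" using A sets_F_subset[of s] st h by auto
  have prod_le: "(\<integral>\<^sup>+\<omega>. indicator A \<omega> * (\<Prod>j<Suc N. \<rho> N j \<omega>) \<partial>M) \<le> emeasure M A" for N
  proof -
    have "(\<integral>\<^sup>+\<omega>. indicator A \<omega> * (\<Prod>j<Suc N. \<rho> N j \<omega>) \<partial>M) \<le> (\<integral>\<^sup>+\<omega>. indicator A \<omega> \<partial>M)"
    proof (rule nn_integral_prod_le[where \<F> = "\<lambda>k. F (r N k)"])
      fix k B assume "k < Suc N" "B \<in> sets (F (r N k))"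
      then show "(\<integral>\<^sup>+\<omega>. indicator B \<omega> * \<rho> N k \<omega> \<partial>M) \<le> emeasure M B"
        unfolding \<rho>_def E_def using r_in'[of k N] r_in'[of "Suc k" N] r_step[of N k]
        by (intro nn_integral_exp_step) auto
    next
      fix k assume "k < Suc N"
      then show "\<rho> N k \<in> borel_measurable (F (r N (Suc k)))" by (rule \<rho>_meas)
      show "sets (F (r N k)) \<subseteq> sets (F (r N (Suc k)))" by (rule sets_F_mono[OF r_step])
    next
      fix k assume "k \<le> Suc N"
      then show "subalgebra M (F (r N k))" by (intro subalgebra_F r_in')
    next
      show "indicator A \<in> borel_measurable (F (r N 0))" using A by (simp add: r0)
    qed
    then show ?thesis by simp
  qed
  have [measurable]: "\<rho> N k \<in> borel_measurable M" if "k < Suc N" for N k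
    using r_in'[of "Suc k" N] that by (intro measurable_F_M[OF \<rho>_meas]) auto
  have lim: "AE \<omega> in M. (\<lambda>N. indicator A \<omega> * (\<Prod>j<Suc N. \<rho> N j \<omega>)) \<longlonglongrightarrow>
      indicator A \<omega> * ennreal (exp (\<psi> t * X t \<omega> - \<psi> s * X s \<omega> - a * (\<Psi> t - \<Psi> s)))"
    using AE_regular
  proof eventually_elim
    case (elim \<omega>)
    \<comment> \<open>After elimination of \<open>I\<close> and \<open>qvar\<close>, the increment
      of \<open>J\<close> carries the coefficient
      \<open>b * \<psi> - \<sigma>\<^sup>2 / 2 * \<psi>\<^sup>2\<close>. By the Riccati equation
      this is the derivative of \<open>\<psi>\<close>, which is exactly what the discrete product
      rule requires.\<close>
    have E_eq: "E N j \<omega> = \<psi> (r N j) * (X (r N (Suc j)) \<omega> - X (r N j) \<omega>) - a * (\<psi> (r N j) * (r N (Suc j) - r N j))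
      + p (r N j) * (J (r N (Suc j)) \<omega> - J (r N j) \<omega>)" if "j < Suc N" for N j
    proof -
      have q: "qvar (r N j) (r N (Suc j)) \<omega> = \<sigma>\<^sup>2 * (J (r N (Suc j)) \<omega> - J (r N j) \<omega>)"
        using that by (intro qvar_eq elim r_in' r_step) auto
      have i: "I (r N (Suc j)) \<omega> - I (r N j) \<omega>
          = (X (r N (Suc j)) \<omega> - X (r N j) \<omega>) - a * (r N (Suc j) - r N j) + b * (J (r N (Suc j)) \<omega> - J (r N j) \<omega>)"
        using regular_I[OF elim r_in'[of j N]] regular_I[OF elim r_in'[of "Suc j" N]] that
        by (simp add: right_diff_distrib)
      show ?thesis unfolding E_def q i p_def by (simp add: field_simps)
    qed
    have Jd: "\<forall>u\<in>{s..t}. ((\<lambda>t. J t \<omega>) has_real_derivative X u \<omega>) (at u within {s..t})"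
      using J_has_derivative[OF elim] st h by auto
    have Xc: "continuous_on {s..t} (\<lambda>t. X t \<omega>)"
      using elim sub h by (auto simp: regular_def intro: continuous_on_subset)
    have "(\<lambda>N. \<Sum>j<Suc N. E N j \<omega>) \<longlonglongrightarrow> \<psi> t * X t \<omega> - \<psi> s * X s \<omega> - a * (\<Psi> t - \<Psi> s)"
      using tendsto_Riemann_Stieltjes_sum[OF st(2) Xc p_cont Jd \<psi> \<Psi>, of a] E_eq
      unfolding r_def by (simp cong: sum.cong_simp)
    then have "(\<lambda>N. ennreal (exp (\<Sum>j<Suc N. E N j \<omega>))) \<longlonglongrightarrow> ennreal (exp (\<psi> t * X t \<omega> - \<psi> s * X s \<omega> - a * (\<Psi> t - \<Psi> s)))"
      by (intro tendsto_ennrealI tendsto_exp)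
    moreover have "(\<Prod>j<Suc N. \<rho> N j \<omega>) = ennreal (exp (\<Sum>j<Suc N. E N j \<omega>))" for N
      unfolding \<rho>_def by (rule prod_ennreal_exp) simp
    ultimately show ?case
      by (auto split: split_indicator simp del: prod.lessThan_Suc sum.lessThan_Suc)
  qed
  have "(\<integral>\<^sup>+\<omega>. indicator A \<omega> * ennreal (exp (\<psi> t * X t \<omega> - \<psi> s * X s \<omega> - a * (\<Psi> t - \<Psi> s))) \<partial>M)
      = (\<integral>\<^sup>+\<omega>. liminf (\<lambda>N. indicator A \<omega> * (\<Prod>j<Suc N. \<rho> N j \<omega>)) \<partial>M)"
    by (rule nn_integral_cong_AE, rule AE_mp[OF lim])
      (auto intro!: lim_imp_Liminf[symmetric] simp del: prod.lessThan_Suc)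
  also have "\<dots> \<le> liminf (\<lambda>N. \<integral>\<^sup>+\<omega>. indicator A \<omega> * (\<Prod>j<Suc N. \<rho> N j \<omega>) \<partial>M)"
    by (rule nn_integral_liminf) (auto intro!: borel_measurable_times borel_measurable_prod_ennreal simp del: prod.lessThan_Suc)
  also have "\<dots> \<le> liminf (\<lambda>N. emeasure M A)"
    by (intro Liminf_mono always_eventually allI prod_le)
  also have "liminf (\<lambda>N. emeasure M A) = emeasure M A"
    by (rule Liminf_const) simp
  finally show ?thesis .
qed

text \<open>On each dyadic grid the factors telescope to the exponential normalised to 1 at time 0,
  and the discrete maximal inequality applies. The events increase with the grid level, so the same
  bound holds for their union.\<close>

lemma exp_supermartingale_maximal:
  fixes y :: real
  assumes ric: "riccati h \<psi> \<Psi>"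
  defines "S \<equiv> {\<omega> \<in> space M. \<exists>N. \<exists>j\<le>2^N. y \<le> \<psi> (h * real j / 2^N) * X (h * real j / 2^N) \<omega> - \<psi> 0 * X 0 \<omega>
      - a * (\<Psi> (h * real j / 2^N) - \<Psi> 0)}"
  shows "S \<in> sets M" and "prob S \<le> exp (- y)"
proof -
  have h: "0 \<le> h" "h \<le> T" using ric by (auto simp: riccati_def)
  define L where "L t \<omega> = \<psi> t * X t \<omega> - a * \<Psi> t" for t \<omega>
  define r where "r N j = h * real j / 2 ^ N" for N j :: nat
  have L: "\<psi> t * X t \<omega> - \<psi> s * X s \<omega> - a * (\<Psi> t - \<Psi> s) = L t \<omega> - L s \<omega>" for s t \<omega>
    by (simp add: L_def algebra_simps)
  have r_in: "0 \<le> r N j" "r N j \<le> h" if "j \<le> 2 ^ N" for N j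
    unfolding r_def using dyadic_bounds[OF h(1) that] by auto
  have r_step: "r N j \<le> r N (Suc j)" for N j
    unfolding r_def using h by (intro divide_right_mono mult_left_mono) auto
  have r0: "r N 0 = 0" for N by (simp add: r_def)
  have L_meas: "L (r N j) \<in> borel_measurable (F (r N k))" if "j \<le> k" "k \<le> 2 ^ N" for N j k
  proof -
    have "r N j \<le> r N k" unfolding r_def using h that by (intro divide_right_mono mult_left_mono) auto
    then have [measurable]: "X (r N j) \<in> borel_measurable (F (r N k))"
      using r_in[of j N] r_in[of k N] that h by (intro X_measurable_F) auto
    show ?thesis unfolding L_def by measurable
  qed
  define U where "U N = {\<omega> \<in> space M. \<exists>j\<le>2^N. y \<le> L (r N j) \<omega> - L 0 \<omega>}" for N
  have LM [measurable]: "L (r N j) \<in> borel_measurable M" if "j \<le> 2^N" for N j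
    using L_meas[of j j N] r_in[OF that] h that by (auto intro: measurable_F_M)
  have U [measurable]: "U N \<in> sets M" for N
  proof -
    have [measurable]: "L 0 \<in> borel_measurable M" using LM[of 0 0] by (simp add: r0)
    have "U N = (\<Union>j\<in>{..2^N}. {\<omega> \<in> space M. y \<le> L (r N j) \<omega> - L 0 \<omega>})" by (auto simp: U_def)
    also have "\<dots> \<in> sets M" by (rule sets.finite_UN) auto
    finally show ?thesis .
  qed
  have bound: "emeasure M (U N) \<le> ennreal (exp (- y))" for N
  proof -
    define \<rho> where "\<rho> j \<omega> = ennreal (exp (L (r N (Suc j)) \<omega> - L (r N j) \<omega>))" for j \<omega>
    have prod: "(\<Prod>j<i. \<rho> j \<omega>) = ennreal (exp (L (r N i) \<omega> - L 0 \<omega>))" for i \<omega>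
    proof -
      have "(\<Prod>j<i. \<rho> j \<omega>) = ennreal (exp (\<Sum>j<i. L (r N (Suc j)) \<omega> - L (r N j) \<omega>))"
        unfolding \<rho>_def by (rule prod_ennreal_exp) simp
      then show ?thesis by (simp add: sum_lessThan_telescope[of "\<lambda>j. L (r N j) \<omega>"] r0)
    qed
    have "ennreal (exp y) * emeasure M {\<omega> \<in> space M. \<exists>i\<le>2^N. ennreal (exp y) \<le> (\<Prod>j<i. \<rho> j \<omega>)} \<le> 1"
    proof (rule prob_prod_ge_le[where \<F> = "\<lambda>k. F (r N k)"])
      fix k assume k: "k < (2::nat) ^ N"
      have [measurable]: "L (r N (Suc k)) \<in> borel_measurable (F (r N (Suc k)))"
        "L (r N k) \<in> borel_measurable (F (r N (Suc k)))"
        using k by (auto intro!: L_meas)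
      show "\<rho> k \<in> borel_measurable (F (r N (Suc k)))" unfolding \<rho>_def by measurable
      show "sets (F (r N k)) \<subseteq> sets (F (r N (Suc k)))" by (rule sets_F_mono[OF r_step])
      fix A assume "A \<in> sets (F (r N k))"
      then show "(\<integral>\<^sup>+\<omega>. indicator A \<omega> * \<rho> k \<omega> \<partial>M) \<le> emeasure M A"
        using exp_supermartingale[OF ric r_in(1)[of k N] r_step[of N k] r_in(2)[of "Suc k" N]] k
        unfolding L \<rho>_def by auto
    next
      fix k assume "k \<le> (2::nat) ^ N"
      then show "subalgebra M (F (r N k))"
        using r_in[of k N] h by (intro subalgebra_F) auto
    qed
    also have "{\<omega> \<in> space M. \<exists>i\<le>2^N. ennreal (exp y) \<le> (\<Prod>j<i. \<rho> j \<omega>)} = U N"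
      by (simp add: prod U_def)
    finally have "exp y * prob (U N) \<le> 1"
      by (simp add: emeasure_eq_measure ennreal_mult[symmetric])
    then show ?thesis
      by (simp add: emeasure_eq_measure exp_minus field_simps)
  qed
  have "incseq U"
  proof (rule incseq_SucI, rule subsetI)
    fix N \<omega> assume "\<omega> \<in> U N"
    then obtain j where j: "j \<le> 2 ^ N" "y \<le> L (r N j) \<omega> - L 0 \<omega>" "\<omega> \<in> space M" by (auto simp: U_def)
    \<comment> \<open>The dyadic grids are nested.\<close>
    have "r (Suc N) (2 * j) = r N j" by (simp add: r_def)
    then show "\<omega> \<in> U (Suc N)"
      using j by (auto simp: U_def intro!: exI[of _ "2 * j"])
  qed
  then have "emeasure M (\<Union>N. U N) = (SUP N. emeasure M (U N))"
    by (intro SUP_emeasure_incseq[symmetric]) auto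
  also have "\<dots> \<le> ennreal (exp (- y))" by (intro SUP_least bound)
  finally have "prob (\<Union>N. U N) \<le> exp (- y)"
    by (simp add: emeasure_eq_measure)
  moreover have "S = (\<Union>N. U N)"
    unfolding S_def L r_def[symmetric] by (auto simp: U_def r0)
  ultimately show "S \<in> sets M" "prob S \<le> exp (- y)"
    by auto
qed

end


section \<open>Concentration\<close>

text \<open>The difference vanishes at 0 and has derivative
  \<open>u\<^sup>2 / (2 * (1 - u)\<^sup>2)\<close>. In terms of series, p^n / n is replaced by p^n /
  2 for all n \<ge> 2.\<close>

lemma neg_ln_one_minus_le:
  fixes p :: real
  assumes "0 \<le> p" "p < 1"
  shows "- ln (1 - p) - p \<le> p\<^sup>2 / (2 * (1 - p))"
proof -
  define f where "f u = u\<^sup>2 / (2 * (1 - u)) + u + ln (1 - u)" for u :: real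
  have "f 0 \<le> f p"
  proof (rule DERIV_nonneg_imp_nondecreasing[OF assms(1)])
    fix u assume u: "0 \<le> u" "u \<le> p"
    then have u1: "0 < 1 - u" using assms by simp
    have "(f has_real_derivative (2 * u * (2 * (1 - u)) + u\<^sup>2 * 2) / (2 * (1 - u))\<^sup>2 + 1 - 1 / (1 - u)) (at u)"
      unfolding f_def using u1 by (auto intro!: derivative_eq_intros simp: power2_eq_square)
    moreover have "(2 * u * (2 * (1 - u)) + u\<^sup>2 * 2) / (2 * (1 - u))\<^sup>2 + 1 - 1 / (1 - u) = u\<^sup>2 / (2 * (1 - u)\<^sup>2)"
      using u1 by (simp add: divide_simps) (simp add: algebra_simps power2_eq_square)
    ultimately show "\<exists>y. (f has_real_derivative y) (at u) \<and> 0 \<le> y"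
      by (metis divide_nonneg_nonneg mult_nonneg_nonneg zero_le_numeral zero_le_power2)
  qed
  then show ?thesis by (simp add: f_def)
qed

section \<open>Explicit Riccati solution, moment generating function and tail bound\<close>

context cir_solution
begin

text \<open>The integral of \<open>\<sigma>\<^sup>2 / 2 * exp (b * r)\<close> over \<open>r\<close>
  from \<open>u\<close> to \<open>h\<close>.\<close>

definition kappa :: "real \<Rightarrow> real \<Rightarrow> real" where
  "kappa h u = \<sigma>\<^sup>2 / (2 * b) * (exp (b * h) - exp (b * u))"

definition riccati_denom :: "real \<Rightarrow> real \<Rightarrow> real \<Rightarrow> real" where
  "riccati_denom \<theta> h u = 1 - \<theta> * kappa h u"

text \<open>The Riccati equation is linear in the reciprocal of its solution; this is its solution
  run backwards from \<open>exp (b * h) * \<theta>\<close> at time \<open>h\<close>. The terminal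
  time varies because the mean is needed at every time, while the maximal inequality uses
  \<open>h = T\<close>.\<close>

definition psi :: "real \<Rightarrow> real \<Rightarrow> real \<Rightarrow> real" where
  "psi \<theta> h u = exp (b * u) * \<theta> / riccati_denom \<theta> h u"

text \<open>The antiderivative of \<open>psi\<close> that vanishes at \<open>h\<close>; a logarithm,
  since the numerator of \<open>psi\<close> is proportional to the derivative of its
  denominator.\<close>

definition Psi :: "real \<Rightarrow> real \<Rightarrow> real \<Rightarrow> real" where
  "Psi \<theta> h u = 2 / \<sigma>\<^sup>2 * ln (riccati_denom \<theta> h u)"

definition mean :: "real \<Rightarrow> real" where
  "mean t = x0 + a / b * (exp (b * t) - 1)"

lemma mean_kappa: "mean h - mean u = 2 * a / \<sigma>\<^sup>2 * kappa h u" "mean h - x0 = 2 * a / \<sigma>\<^sup>2 * kappa h 0"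
  using b_pos \<sigma>_pos by (auto simp: mean_def kappa_def field_simps)

lemma kappa_nonneg: "u \<le> h \<Longrightarrow> 0 \<le> kappa h u"
  using b_pos by (auto simp: kappa_def)

lemma kappa_antimono: "0 \<le> u \<Longrightarrow> kappa h u \<le> kappa h 0"
  using b_pos unfolding kappa_def by (intro mult_left_mono) auto

lemma riccati_denom_pos:
  assumes "\<theta> * kappa h 0 < 1" "0 \<le> u" "u \<le> h"
  shows "0 < riccati_denom \<theta> h u"
proof (cases "0 \<le> \<theta>")
  case True
  then have "\<theta> * kappa h u \<le> \<theta> * kappa h 0"
    using kappa_antimono assms by (intro mult_left_mono) auto
  then show ?thesis using assms(1) by (simp add: riccati_denom_def)
next
  case False
  then have "\<theta> * kappa h u \<le> 0"
    using kappa_nonneg[OF assms(3)] by (intro mult_nonpos_nonneg) auto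
  then show ?thesis by (simp add: riccati_denom_def)
qed

lemma riccati_psi:
  assumes h: "0 \<le> h" "h \<le> T" and \<theta>: "\<theta> * kappa h 0 < 1"
  shows "riccati h (psi \<theta> h) (Psi \<theta> h)"
  unfolding riccati_def
proof (intro conjI ballI h)
  fix u assume "u \<in> {0..h}"
  then have pos: "0 < riccati_denom \<theta> h u" using riccati_denom_pos[OF \<theta>] by auto
  have d: "(riccati_denom \<theta> h has_real_derivative \<theta> * \<sigma>\<^sup>2 / 2 * exp (b * u)) (at u)"
    unfolding riccati_denom_def[abs_def] kappa_def using b_pos
    by (auto intro!: derivative_eq_intros)
  have "(psi \<theta> h has_real_derivative
      (exp (b * u) * b * \<theta> * riccati_denom \<theta> h u - exp (b * u) * \<theta> * (\<theta> * \<sigma>\<^sup>2 / 2 * exp (b * u)))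
        / (riccati_denom \<theta> h u * riccati_denom \<theta> h u)) (at u)"
    unfolding psi_def[abs_def] using pos by (auto intro!: derivative_eq_intros d)
  moreover have "(exp (b * u) * b * \<theta> * riccati_denom \<theta> h u - exp (b * u) * \<theta> * (\<theta> * \<sigma>\<^sup>2 / 2 * exp (b * u)))
        / (riccati_denom \<theta> h u * riccati_denom \<theta> h u) = b * psi \<theta> h u - \<sigma>\<^sup>2 / 2 * (psi \<theta> h u)\<^sup>2"
    using pos by (simp add: psi_def divide_simps power2_eq_square)
  ultimately show "(psi \<theta> h has_real_derivative b * psi \<theta> h u - \<sigma>\<^sup>2 / 2 * (psi \<theta> h u)\<^sup>2) (at u within {0..h})"
    by (auto intro: has_field_derivative_at_within)
  have "(Psi \<theta> h has_real_derivative 2 / \<sigma>\<^sup>2 * (1 / riccati_denom \<theta> h u * (\<theta> * \<sigma>\<^sup>2 / 2 * exp (b * u)))) (at u)"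
    unfolding Psi_def[abs_def] by (intro DERIV_cmult DERIV_chain2[OF DERIV_ln_divide[OF pos] d])
  moreover have cancel: "2 / s * (1 / q * (\<theta> * s / 2 * e)) = e * \<theta> / q" if "s \<noteq> 0" for s q e :: real
    using that by simp
  moreover have "2 / \<sigma>\<^sup>2 * (1 / riccati_denom \<theta> h u * (\<theta> * \<sigma>\<^sup>2 / 2 * exp (b * u))) = psi \<theta> h u"
    unfolding psi_def using \<sigma>_pos by (subst cancel) auto
  ultimately show "(Psi \<theta> h has_real_derivative psi \<theta> h u) (at u within {0..h})"
    by (auto intro: has_field_derivative_at_within)
qed

lemma psi_end [simp]: "psi \<theta> h h = exp (b * h) * \<theta>" "Psi \<theta> h h = 0"
  by (simp_all add: psi_def Psi_def riccati_denom_def kappa_def)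

definition log_mgf :: "real \<Rightarrow> real \<Rightarrow> real" where
  "log_mgf \<theta> h = \<theta> * x0 / (1 - \<theta> * kappa h 0) - 2 * a / \<sigma>\<^sup>2 * ln (1 - \<theta> * kappa h 0)"

lemma log_mgf_eq: "psi \<theta> h 0 * x0 - a * Psi \<theta> h 0 = log_mgf \<theta> h"
  by (simp add: log_mgf_def psi_def Psi_def riccati_denom_def)

lemma mgf_le:
  assumes h: "0 \<le> h" "h \<le> T" and \<theta>: "\<theta> * kappa h 0 < 1"
  shows "(\<integral>\<^sup>+\<omega>. ennreal (exp (\<theta> * exp (b * h) * X h \<omega> - log_mgf \<theta> h)) \<partial>M) \<le> 1"
proof -
  have "(\<integral>\<^sup>+\<omega>. ennreal (exp (\<theta> * exp (b * h) * X h \<omega> - log_mgf \<theta> h)) \<partial>M)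
      = (\<integral>\<^sup>+\<omega>. indicator (space M) \<omega> * ennreal (exp (psi \<theta> h h * X h \<omega> - psi \<theta> h 0 * X 0 \<omega> - a * (Psi \<theta> h h - Psi \<theta> h 0))) \<partial>M)"
  proof (rule nn_integral_cong_AE)
    show "AE \<omega> in M. ennreal (exp (\<theta> * exp (b * h) * X h \<omega> - log_mgf \<theta> h))
      = indicator (space M) \<omega> * ennreal (exp (psi \<theta> h h * X h \<omega> - psi \<theta> h 0 * X 0 \<omega> - a * (Psi \<theta> h h - Psi \<theta> h 0)))"
      using AE_regular AE_space
    proof eventually_elim
      case (elim \<omega>)
      then have "X 0 \<omega> = x0" by (simp add: regular_def)
      then show ?case using elim by (simp add: log_mgf_eq[symmetric] mult.commute[of \<theta>])
    qed
  qed
  also have "\<dots> \<le> emeasure M (space M)"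
    by (rule exp_supermartingale[OF riccati_psi[OF h \<theta>]]) (use h sets.top[of "F 0"] in auto)
  finally show ?thesis by (simp add: emeasure_space_1)
qed

lemma integrable_exp:
  assumes h: "0 \<le> h" "h \<le> T" and \<theta>: "\<theta> * kappa h 0 < 1"
  shows "integrable M (\<lambda>\<omega>. exp (\<theta> * exp (b * h) * X h \<omega> - log_mgf \<theta> h))"
    and "expectation (\<lambda>\<omega>. exp (\<theta> * exp (b * h) * X h \<omega> - log_mgf \<theta> h)) \<le> 1"
proof -
  have [measurable]: "X h \<in> borel_measurable M" by (rule X_measurable[OF h])
  show int: "integrable M (\<lambda>\<omega>. exp (\<theta> * exp (b * h) * X h \<omega> - log_mgf \<theta> h))"
    by (rule integrableI_nonneg) (use mgf_le[OF assms] in \<open>auto intro: le_less_trans\<close>)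
  have "ennreal (expectation (\<lambda>\<omega>. exp (\<theta> * exp (b * h) * X h \<omega> - log_mgf \<theta> h))) \<le> 1"
    using mgf_le[OF assms] by (subst nn_integral_eq_integral[symmetric, OF int]) auto
  then show "expectation (\<lambda>\<omega>. exp (\<theta> * exp (b * h) * X h \<omega> - log_mgf \<theta> h)) \<le> 1"
    by (simp add: ennreal_le_1)
qed

lemma integrable_X:
  assumes h: "0 \<le> h" "h \<le> T"
  shows "integrable M (X h)"
proof -
  have [measurable]: "X h \<in> borel_measurable M" by (rule X_measurable[OF h])
  \<comment> \<open>Any positive exponent below the singularity would do; this choice also covers
    \<open>kappa h 0 = 0\<close>, which occurs at \<open>h = 0\<close>.\<close>
  define \<theta> where "\<theta> = 1 / (1 + kappa h 0)"
  have k: "0 \<le> kappa h 0" using kappa_nonneg[OF h(1)] .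
  then have \<theta>: "0 < \<theta>" "\<theta> * kappa h 0 < 1" by (auto simp: \<theta>_def)
  define c where "c = \<theta> * exp (b * h)"
  have c: "0 < c" using \<theta> by (simp add: c_def)
  show ?thesis
  proof (rule Bochner_Integration.integrable_bound)
    show "integrable M (\<lambda>\<omega>. exp (log_mgf \<theta> h) / c * exp (\<theta> * exp (b * h) * X h \<omega> - log_mgf \<theta> h))"
      by (intro integrable_mult_right integrable_exp(1) h \<theta>)
    show "AE \<omega> in M. norm (X h \<omega>) \<le> norm (exp (log_mgf \<theta> h) / c * exp (\<theta> * exp (b * h) * X h \<omega> - log_mgf \<theta> h))"
      using AE_regular
    proof eventually_elim
      case (elim \<omega>)
      have "0 < X h \<omega>" using elim h by (simp add: regular_def)
      have "c * X h \<omega> \<le> exp (c * X h \<omega>)" using exp_ge_add_one_self[of "c * X h \<omega>"] by linarith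
      then have "X h \<omega> \<le> exp (c * X h \<omega>) / c" using c by (simp add: field_simps)
      also have "\<dots> = exp (log_mgf \<theta> h) / c * exp (\<theta> * exp (b * h) * X h \<omega> - log_mgf \<theta> h)"
        by (simp add: c_def exp_diff)
      finally show ?case using \<open>0 < X h \<omega>\<close> c by simp
    qed
  qed simp
qed

text \<open>Negative exponents \<open>\<theta> = - \<mu>\<close> with \<open>\<mu>\<close> tending to 0 give the lower bound on the mean, without a proof
  that the martingale part of \<open>X\<close> is a true martingale.\<close>

lemma mean_le_expectation:
  assumes h: "0 \<le> h" "h \<le> T"
  shows "mean h \<le> exp (b * h) * expectation (X h)"
proof -
  define k where "k = kappa h 0"
  define Y where "Y = exp (b * h) * expectation (X h)"
  have k: "0 \<le> k" using kappa_nonneg[OF h(1)] by (simp add: k_def)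
  note int = integrable_X[OF h]
  have le: "mean h \<le> Y * (1 + \<mu> * k)" if \<mu>: "0 < \<mu>" for \<mu>
  proof -
    have \<mu>k: "0 \<le> \<mu> * k" using \<mu> k by simp
    then have \<theta>: "- \<mu> * kappa h 0 < 1" by (simp add: k_def)
    \<comment> \<open>Bounding the exponential below by its tangent at 0 turns the bound on the
      exponential moment into a linear inequality for the expectation of \<open>X h\<close>.\<close>
    have "expectation (\<lambda>\<omega>. 1 + (- \<mu> * exp (b * h) * X h \<omega> - log_mgf (- \<mu>) h))
        \<le> expectation (\<lambda>\<omega>. exp (- \<mu> * exp (b * h) * X h \<omega> - log_mgf (- \<mu>) h))"
      by (intro integral_mono integrable_exp(1)[OF h \<theta>] exp_ge_add_one_self Bochner_Integration.integrable_add
          Bochner_Integration.integrable_diff integrable_mult_right int integrable_const)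
    also have "\<dots> \<le> 1" by (rule integrable_exp(2)[OF h \<theta>])
    finally have "- \<mu> * exp (b * h) * expectation (X h) - log_mgf (- \<mu>) h \<le> 0"
      using int by (simp add: prob_space)
    then have 1: "- log_mgf (- \<mu>) h \<le> \<mu> * Y" by (simp add: Y_def)
    \<comment> \<open>This lower bound for the logarithm has the same denominator
      \<open>1 + \<mu> * k\<close> as the term with \<open>x0\<close>, so that the two numerators
      combine to \<open>mean h\<close>.\<close>
    have "ln (1 / (1 + \<mu> * k)) \<le> 1 / (1 + \<mu> * k) - 1"
      using \<mu>k by (intro ln_le_minus_one) auto
    then have "\<mu> * k / (1 + \<mu> * k) \<le> ln (1 + \<mu> * k)"
      using \<mu>k by (simp add: ln_div field_simps)
    then have "2 * a / \<sigma>\<^sup>2 * (\<mu> * k / (1 + \<mu> * k)) \<le> 2 * a / \<sigma>\<^sup>2 * ln (1 + \<mu> * k)"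
      using a_pos by (intro mult_left_mono) auto
    then have "\<mu> * x0 / (1 + \<mu> * k) + 2 * a / \<sigma>\<^sup>2 * (\<mu> * k / (1 + \<mu> * k)) \<le> \<mu> * Y"
      using 1 by (simp add: log_mgf_def k_def)
    moreover have "\<mu> * x0 / (1 + \<mu> * k) + 2 * a / \<sigma>\<^sup>2 * (\<mu> * k / (1 + \<mu> * k))
        = \<mu> * ((x0 + 2 * a / \<sigma>\<^sup>2 * k) / (1 + \<mu> * k))"
      by (simp add: add_divide_distrib algebra_simps)
    moreover have "x0 + 2 * a / \<sigma>\<^sup>2 * k = mean h" using mean_kappa(2)[of h] by (simp add: k_def)
    ultimately have "\<mu> * (mean h / (1 + \<mu> * k)) \<le> \<mu> * Y"
      by metis
    then have "mean h / (1 + \<mu> * k) \<le> Y"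
      using \<mu> by (rule mult_left_le_imp_le)
    then show ?thesis using \<mu>k by (simp add: pos_divide_le_eq)
  qed
  \<comment> \<open>The common factor \<open>\<mu>\<close> has been cancelled, and the remaining
    loss disappears as \<open>\<mu>\<close> tends to 0.\<close>
  have "(\<lambda>n. Y * (1 + inverse (real (Suc n)) * k)) \<longlonglongrightarrow> Y * (1 + 0 * k)"
    by (intro tendsto_intros LIMSEQ_inverse_real_of_nat)
  then have "mean h \<le> Y * (1 + 0 * k)"
    by (rule LIMSEQ_le_const) (use le in auto)
  then show ?thesis by (simp add: Y_def)
qed

text \<open>Subtracting \<open>\<theta> * mean T\<close> removes the first-order part. The remainder
  of the \<open>x0\<close> term is an exact geometric tail, the logarithm is estimated by
  \<open>neg_ln_one_minus_le\<close>, and both have the denominator \<open>1 - p\<close>; their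
  numerators add up to half the variance times \<open>\<theta>\<^sup>2\<close>.\<close>

lemma log_mgf_le:
  assumes \<theta>: "0 \<le> \<theta>" "\<theta> * kappa T 0 < 1"
  shows "log_mgf \<theta> T - \<theta> * mean T \<le> \<theta>\<^sup>2 * CIR_sigma_bar_sq T x0 a b \<sigma> / (2 * (1 - \<theta> * kappa T 0))"
proof -
  define k where "k = kappa T 0"
  define p where "p = \<theta> * k"
  have k: "0 \<le> k" using kappa_nonneg[of 0 T] T_pos by (simp add: k_def)
  have p: "0 \<le> p" "p < 1" using \<theta> k by (auto simp: p_def k_def)
  have v: "CIR_sigma_bar_sq T x0 a b \<sigma> = 2 * (x0 * k + a / \<sigma>\<^sup>2 * k\<^sup>2)"
    using b_pos \<sigma>_pos by (simp add: CIR_sigma_bar_sq_def k_def kappa_def field_simps power2_eq_square)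
  have m: "mean T = x0 + 2 * a / \<sigma>\<^sup>2 * k" using mean_kappa(2)[of T] by (simp add: k_def)
  define c where "c = 2 * a / \<sigma>\<^sup>2"
  have e1: "\<theta> * x0 / (1 - p) = \<theta> * x0 + \<theta> * x0 * (p / (1 - p))"
    using p by (simp add: field_simps)
  have "log_mgf \<theta> T - \<theta> * mean T = (\<theta> * x0 / (1 - p) - c * ln (1 - p)) - \<theta> * (x0 + c * k)"
    by (simp add: log_mgf_def m c_def k_def[symmetric] p_def[symmetric])
  also have "\<dots> = \<theta> * x0 * (p / (1 - p)) + c * (- ln (1 - p) - p)"
    unfolding e1 by (simp add: algebra_simps) (simp add: p_def)
  also have "\<dots> \<le> \<theta> * x0 * (p / (1 - p)) + c * (p\<^sup>2 / (2 * (1 - p)))"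
    using neg_ln_one_minus_le[OF p] a_pos unfolding c_def by (intro add_left_mono mult_left_mono) auto
  also have "\<dots> = (\<theta> * x0 * p + c / 2 * p\<^sup>2) / (1 - p)"
    by (simp add: add_divide_distrib)
  also have "\<theta> * x0 * p + c / 2 * p\<^sup>2 = \<theta>\<^sup>2 * (x0 * k + a / \<sigma>\<^sup>2 * k\<^sup>2)"
    by (simp add: p_def c_def algebra_simps power2_eq_square)
  also have "\<theta>\<^sup>2 * (x0 * k + a / \<sigma>\<^sup>2 * k\<^sup>2) / (1 - p) = \<theta>\<^sup>2 * CIR_sigma_bar_sq T x0 a b \<sigma> / (2 * (1 - p))"
    unfolding v mult.left_commute[of "\<theta>\<^sup>2" 2] by (subst mult_divide_mult_cancel_left) auto
  finally show ?thesis by (simp add: p_def k_def)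
qed

text \<open>Makes the level independent of the time \<open>t\<close> of exceedance. The denominator
  of \<open>psi\<close> is at most 1, so \<open>psi\<close> is at least
  \<open>\<theta> * exp (b * t)\<close>; and by \<open>ln q \<le> q - 1\<close> the term with
  \<open>Psi\<close> supplies at least \<open>\<theta>\<close> times the growth of
  \<open>mean\<close> from \<open>t\<close> to \<open>T\<close>.\<close>

lemma exponent_lower_bound:
  assumes \<theta>: "0 < \<theta>" "\<theta> * kappa T 0 < 1" and t: "0 \<le> t" "t \<le> T" and x: "0 \<le> x"
    and X0: "X 0 \<omega> = x0" and big: "x < exp (b * t) * X t \<omega> - mean t"
  shows "\<theta> * (x + mean T) - log_mgf \<theta> T
    \<le> psi \<theta> T t * X t \<omega> - psi \<theta> T 0 * X 0 \<omega> - a * (Psi \<theta> T t - Psi \<theta> T 0)"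
proof -
  define q where "q = riccati_denom \<theta> T t"
  have q: "0 < q" using riccati_denom_pos[OF \<theta>(2) t] by (simp add: q_def)
  have q1: "1 - q = \<theta> * kappa T t" by (simp add: q_def riccati_denom_def)
  have "0 \<le> 1 - q" unfolding q1 using \<theta> kappa_nonneg[OF t(2)] by simp
  then have "q \<le> 1" by simp
  have mt: "0 \<le> mean t" using x0_pos a_pos b_pos t by (simp add: mean_def)
  have "\<theta> * (x + mean t) * 1 \<le> \<theta> * (x + mean t) * (1 / q)"
    using \<theta> x mt q \<open>q \<le> 1\<close> by (intro mult_left_mono) auto
  also have "\<dots> = \<theta> / q * (x + mean t)" by simp
  also have "\<dots> \<le> \<theta> / q * (exp (b * t) * X t \<omega>)"
    using \<theta> q big by (intro mult_left_mono) auto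
  also have "\<dots> = psi \<theta> T t * X t \<omega>" by (simp add: psi_def q_def mult.commute)
  finally have 1: "\<theta> * (x + mean t) \<le> psi \<theta> T t * X t \<omega>" by simp
  have "2 * a / \<sigma>\<^sup>2 * ln q \<le> 2 * a / \<sigma>\<^sup>2 * (q - 1)"
    using q a_pos by (intro mult_left_mono ln_le_minus_one) auto
  also have "q - 1 = - (\<theta> * kappa T t)" using q1 by simp
  also have "2 * a / \<sigma>\<^sup>2 * - (\<theta> * kappa T t) = - \<theta> * (2 * a / \<sigma>\<^sup>2 * kappa T t)" by simp
  also have "\<dots> = - \<theta> * (mean T - mean t)" by (simp add: mean_kappa)
  finally have 2: "a * Psi \<theta> T t \<le> - \<theta> * (mean T - mean t)"
    by (simp add: Psi_def q_def mult.commute)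
  show ?thesis
    using 1 2 unfolding X0 log_mgf_eq[symmetric] by (simp add: algebra_simps)
qed

text \<open>The event with the supremum is contained, up to a null set, in the measurable event of
  the maximal inequality, and monotonicity needs measurability of the larger event only.\<close>

lemma prob_sup_le:
  assumes x: "0 < x"
  defines "w \<equiv> CIR_sigma_bar T x0 a b \<sigma>"
    and "R \<equiv> sqrt (CIR_sigma_bar_sq T x0 a b \<sigma> + \<sigma>\<^sup>2 / b * (exp (b * T) - 1) * x)"
  shows "prob {\<omega> \<in> space M. (SUP t\<in>{0..T}. exp (b * t) * (X t \<omega> - expectation (X t))) > x}
    \<le> exp (- (2 * x\<^sup>2 / (w + R)\<^sup>2))"
proof -
  let ?v = "CIR_sigma_bar_sq T x0 a b \<sigma>"
  define k where "k = kappa T 0"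
  have e: "0 < exp (b * T) - 1" using b_pos T_pos by simp
  have k: "0 < k" "\<sigma>\<^sup>2 / b * (exp (b * T) - 1) = 2 * k"
    using e b_pos \<sigma>_pos by (auto simp: k_def kappa_def)
  have v: "0 < ?v"
    unfolding CIR_sigma_bar_sq_def using e b_pos \<sigma>_pos x0_pos a_pos
    by (intro mult_pos_pos add_pos_pos) auto
  have w: "0 < w" "w\<^sup>2 = ?v" using v by (auto simp: w_def CIR_sigma_bar_def)
  have R2: "R\<^sup>2 = w\<^sup>2 + 2 * k * x"
    unfolding R_def k(2) w(2) using v k(1) x by (intro real_sqrt_pow2) (simp add: less_imp_le)
  have R: "0 < R" unfolding R_def k(2) using v k(1) x by (simp add: add_pos_pos)
  \<comment> \<open>The minimiser of \<open>\<theta>\<^sup>2 * w\<^sup>2 / (2 * (1 - \<theta> * k))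
    - \<theta> * x\<close>: the derivative vanishes when \<open>1 - \<theta> * k = w / R\<close>,
    and \<open>R\<^sup>2 - w\<^sup>2 = 2 * k * x\<close> brings \<theta> into this form.\<close>
  define \<theta> where "\<theta> = 2 * x / (R * (R + w))"
  have \<theta>: "0 < \<theta>" using x R w by (simp add: \<theta>_def)
  have "\<theta> * k = (R\<^sup>2 - w\<^sup>2) / (R * (R + w))" unfolding R2 by (simp add: \<theta>_def)
  also have "\<dots> = ((R - w) * (R + w)) / (R * (R + w))" by (simp add: power2_eq_square algebra_simps)
  also have "\<dots> = (R - w) / R" using R w by simp
  finally have q: "1 - \<theta> * k = w / R" using R by (simp add: diff_divide_distrib)
  have \<theta>k: "\<theta> * kappa T 0 < 1"
  proof -
    have "0 < w / R" using w R by simp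
    then show ?thesis using q by (simp add: k_def)
  qed
  define y where "y = \<theta> * (x + mean T) - log_mgf \<theta> T"
  have "- y = (log_mgf \<theta> T - \<theta> * mean T) - \<theta> * x" by (simp add: y_def algebra_simps)
  also have "\<dots> \<le> \<theta>\<^sup>2 * ?v / (2 * (1 - \<theta> * kappa T 0)) - \<theta> * x"
    using log_mgf_le[OF less_imp_le[OF \<theta>] \<theta>k] by simp
  also have "\<dots> = \<theta> * (\<theta> * (w * R / 2) - x)"
    unfolding k_def[symmetric] q w(2)[symmetric] using w R by (simp add: field_simps power2_eq_square)
  also have "\<theta> * (w * R / 2) - x = - (x * R / (R + w))"
    using w R by (simp add: \<theta>_def divide_simps) (simp add: algebra_simps)
  also have "\<theta> * - (x * R / (R + w)) = - (2 * x\<^sup>2 / (w + R)\<^sup>2)"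
    using w R by (simp add: \<theta>_def power2_eq_square add.commute)
  finally have y: "exp (- y) \<le> exp (- (2 * x\<^sup>2 / (w + R)\<^sup>2))" by simp
  note maximal = exp_supermartingale_maximal[OF riccati_psi[OF less_imp_le[OF T_pos] order_refl \<theta>k], of y]
  have "prob {\<omega> \<in> space M. (SUP t\<in>{0..T}. exp (b * t) * (X t \<omega> - expectation (X t))) > x}
      \<le> prob {\<omega> \<in> space M. \<exists>N. \<exists>j\<le>2^N. y \<le> psi \<theta> T (T * real j / 2^N) * X (T * real j / 2^N) \<omega>
        - psi \<theta> T 0 * X 0 \<omega> - a * (Psi \<theta> T (T * real j / 2^N) - Psi \<theta> T 0)}"
  proof (rule finite_measure_mono_AE[OF _ maximal(1)])
    show "AE \<omega> in M. \<omega> \<in> {\<omega> \<in> space M. (SUP t\<in>{0..T}. exp (b * t) * (X t \<omega> - expectation (X t))) > x}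
      \<longrightarrow> \<omega> \<in> {\<omega> \<in> space M. \<exists>N. \<exists>j\<le>2^N. y \<le> psi \<theta> T (T * real j / 2^N) * X (T * real j / 2^N) \<omega>
        - psi \<theta> T 0 * X 0 \<omega> - a * (Psi \<theta> T (T * real j / 2^N) - Psi \<theta> T 0)}"
      using AE_regular
    proof eventually_elim
      case (elim \<omega>)
      show ?case
      proof
        assume \<omega>: "\<omega> \<in> {\<omega> \<in> space M. (SUP t\<in>{0..T}. exp (b * t) * (X t \<omega> - expectation (X t))) > x}"
        \<comment> \<open>By contraposition, so that boundedness of the path and the value of
          \<open>SUP\<close> on unbounded sets do not matter.\<close>
        have "\<exists>t\<in>{0..T}. x < exp (b * t) * (X t \<omega> - expectation (X t))"
        proof (rule ccontr)
          assume "\<not> ?thesis"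
          then have "(SUP t\<in>{0..T}. exp (b * t) * (X t \<omega> - expectation (X t))) \<le> x"
            using T_pos by (intro cSUP_least) (auto simp: not_less)
          then show False using \<omega> by simp
        qed
        then obtain t where t: "t \<in> {0..T}" "x < exp (b * t) * (X t \<omega> - expectation (X t))" by blast
        \<comment> \<open>The expectation is replaced by \<open>mean\<close> before moving to a
          dyadic time: \<open>mean\<close> is visibly continuous in \<open>t\<close>, whereas
          continuity of the expectation has not been established.\<close>
        then have big: "x < exp (b * t) * X t \<omega> - mean t"
          using mean_le_expectation[of t] by (simp add: right_diff_distrib)
        have cont: "continuous_on {0..T} (\<lambda>t. exp (b * t) * X t \<omega> - mean t)"
          using elim unfolding regular_def mean_def by (intro continuous_intros) auto
        obtain N j :: nat where Nj: "j \<le> 2 ^ N"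
          "x < exp (b * (T * real j / 2 ^ N)) * X (T * real j / 2 ^ N) \<omega> - mean (T * real j / 2 ^ N)"
          by (rule dyadic_witness[OF cont t(1) big])
        from exponent_lower_bound[OF \<theta> \<theta>k dyadic_bounds[OF less_imp_le[OF T_pos] Nj(1)] less_imp_le[OF x] _ Nj(2)] elim
        have "y \<le> psi \<theta> T (T * real j / 2^N) * X (T * real j / 2^N) \<omega>
          - psi \<theta> T 0 * X 0 \<omega> - a * (Psi \<theta> T (T * real j / 2^N) - Psi \<theta> T 0)"
          by (simp add: regular_def y_def)
        then show "\<omega> \<in> {\<omega> \<in> space M. \<exists>N. \<exists>j\<le>2^N. y \<le> psi \<theta> T (T * real j / 2^N) * X (T * real j / 2^N) \<omega>
          - psi \<theta> T 0 * X 0 \<omega> - a * (Psi \<theta> T (T * real j / 2^N) - Psi \<theta> T 0)}"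
          using \<omega> Nj(1) by blast
      qed
    qed
  qed
  also have "\<dots> \<le> exp (- y)" by (rule maximal(2))
  also note y
  finally show ?thesis .
qed

end

theorem proposition4p3:
  fixes M :: "'a measure"
    and B X :: "real \<Rightarrow> 'a \<Rightarrow> real"
    and T x\<^sub>0 a b \<sigma> x :: real
  assumes "prob_space M" and "complete_measure M"
    and "T > 0"
    and "brownian_motion M T B"
    and "x\<^sub>0 > 0" and "a > 0" and "b > 0" and "\<sigma> > 0"
    and "2 * a > \<sigma>\<^sup>2"
    and "positive_CIR_solution M T B x\<^sub>0 a b \<sigma> X"
    and "x \<ge> 0"
  shows "measure M {\<omega> \<in> space M.
            (SUP t\<in>{0..T}. exp (b * t) * (X t \<omega> - prob_space.expectation M (X t))) > x}
         \<le> 2 * exp (- (2 * x\<^sup>2 /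
              (CIR_sigma_bar T x\<^sub>0 a b \<sigma>
                + sqrt (CIR_sigma_bar_sq T x\<^sub>0 a b \<sigma>
                          + sqrt 2 * \<sigma>\<^sup>2 / b * (exp (b * T) - 1) * x))\<^sup>2))"
proof (cases "x = 0")
  case True
  interpret prob_space M by fact
  \<comment> \<open>At \<open>x = 0\<close> the optimal exponent degenerates to 0, but the
    right-hand side is 2.\<close>
  show ?thesis
    unfolding True by (rule order_trans[OF prob_le_1]) simp
next
  case False
  then have x: "0 < x" using assms by simp
  from assms(10) obtain I where "has_ito_integral M T B (\<lambda>s \<omega>. \<sigma> * sqrt (X s \<omega>)) I"
    "AE \<omega> in M. \<forall>t\<in>{0..T}. X t \<omega> = x\<^sub>0 + (LBINT s:{0..t}. a - b * X s \<omega>) + I t \<omega>"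
    unfolding positive_CIR_solution_def by blast
  with assms interpret cir_solution M T B x\<^sub>0 a b \<sigma> X I
    by (auto intro!: cir_solution.intro brownian.intro brownian_axioms.intro cir_solution_axioms.intro
        simp: positive_CIR_solution_def)
  let ?w = "CIR_sigma_bar T x\<^sub>0 a b \<sigma>" and ?v = "CIR_sigma_bar_sq T x\<^sub>0 a b \<sigma>"
  let ?c = "\<sigma>\<^sup>2 / b * (exp (b * T) - 1) * x"
  have c: "0 \<le> ?c" using b_pos T_pos x by simp
  have v: "0 < ?v"
    unfolding CIR_sigma_bar_sq_def using b_pos T_pos \<sigma>_pos x0_pos a_pos
    by (intro mult_pos_pos add_pos_pos) auto
  have w: "0 < ?w" using v by (simp add: CIR_sigma_bar_def)
  \<comment> \<open>The factor \<open>sqrt 2\<close> only enlarges the denominator of the exponent,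
    hence weakens the bound.\<close>
  have "1 * ?c \<le> sqrt 2 * ?c" using c by (intro mult_right_mono) auto
  then have "sqrt (?v + ?c) \<le> sqrt (?v + sqrt 2 * \<sigma>\<^sup>2 / b * (exp (b * T) - 1) * x)"
    by simp
  then have "(?w + sqrt (?v + ?c))\<^sup>2 \<le> (?w + sqrt (?v + sqrt 2 * \<sigma>\<^sup>2 / b * (exp (b * T) - 1) * x))\<^sup>2"
    using w v c by (intro power_mono add_left_mono) auto
  moreover have "0 < (?w + sqrt (?v + ?c))\<^sup>2"
    using w v c by (intro zero_less_power add_pos_nonneg) auto
  ultimately have "2 * x\<^sup>2 / (?w + sqrt (?v + sqrt 2 * \<sigma>\<^sup>2 / b * (exp (b * T) - 1) * x))\<^sup>2
      \<le> 2 * x\<^sup>2 / (?w + sqrt (?v + ?c))\<^sup>2"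
    by (intro divide_left_mono mult_pos_pos) auto
  then have "exp (- (2 * x\<^sup>2 / (?w + sqrt (?v + ?c))\<^sup>2))
      \<le> exp (- (2 * x\<^sup>2 / (?w + sqrt (?v + sqrt 2 * \<sigma>\<^sup>2 / b * (exp (b * T) - 1) * x))\<^sup>2))"
    by simp
  then show ?thesis
    using prob_sup_le[OF x] by (smt (verit) exp_gt_zero)
qed

end
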